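(* Let $p$ be a monic complex polynomial of degree $d\ge 2$, let $a\in\mathbb C$, $a\neq 0$, and let $H:\mathbb C^2\to\mathbb C^2$, $H(x,y)=(p(x)-ay,\,x)$. Let $\tilde X_H$ be the surface obtained from $\mathbb P^2$ by the explicit sequence of $2d-1$ point blow-ups described in the context, and let $\tilde D=\tilde X_H-\mathbb C^2$. Then $H$ extends to a morphism $\tilde H:\tilde X_H\to\mathbb P^2$ which maps the divisor at infinity $\tilde D$ to the line at infinity $l_\infty$, mapping all of $\tilde D$ to the point $\mathbf q=[1:0:0]$ except the last exceptional divisor, which is mapped to $l_\infty$ by an isomorphism.
   Context: $\mathbb C^2$ is embedded in $\mathbb P^2=\mathbb P^2_{\mathbb C}$ by $(x,y)\mapsto[x:y:1]$; $l_\infty=\{[x:y:0]\}$. The blow-ups defining $\tilde X_H$. Let $\tilde p(x,z)=z^d p(x/z)$ and $q(X)=\tilde p(1,X)$, a polynomial with constant term $1$. Define $q_0=q$ and $q_{k+1}(X)=\bigl(q_k(X)-q_k(0)\bigr)/X$; define numbers $Q_0=1$ and $Q_{k+1}=-\sum_{j=0}^{k}Q_j\,q_{k-j+1}(0)$. Use the affine coordinates $u=x/y$, $v=1/y$ of $\mathbb P^2$ near the point $\mathbf p=[0:1:0]$. (1) Blow up the point $u=v=0$, and use the coordinates $(u,X_1)$ with $v=X_1u$. (2) Blow up the point $u=X_1=0$, and use the coordinates $(X_1,X_2)$ with $u=X_1X_2$; then, successively for $k=2,\dots,d-1$, blow up the point $X_1=X_k=0$, and use the coordinates $(X_1,X_{k+1})$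 with $X_k=X_1X_{k+1}$. (This is $d-1$ blow-ups.) (3) Put $Y_0=X_d$. Successively for $k=0,\dots,d-2$, blow up the point $X_1=0,\ Y_k=aQ_k$, and use the coordinates $(X_1,Y_{k+1})$ with $Y_k-aQ_k=X_1Y_{k+1}$. (This is $d-1$ blow-ups.) The result of these $2d-1$ blow-ups is $\tilde X_H$. All blown-up points lie over $l_\infty$, so $\mathbb C^2\subset\tilde X_H$. The last exceptional divisor is the exceptional divisor of the $(2d-1)$-st blow-up. *)

theory Defs
  imports "HOL-Analysis.Analysis" "HOL-Computational_Algebra.Computational_Algebra"
begin

section \<open>Spaces with functions\<close>

text \<open>
  Complex algebraic varieties are treated classically, in the manner of Serre: a topological space
  (the Zariski topology) together with, for every open set \<open>U\<close>, the complex functions that are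
  regular on \<open>U\<close>. Functions are total in HOL; membership in \<open>Reg X U\<close> only ever depends on the
  values on \<open>U\<close>, and \<open>Reg X U\<close> is only meant to be used for open \<open>U\<close>.
\<close>

record 'a fspace =
  Top :: "'a topology"
  Reg :: "'a set \<Rightarrow> ('a \<Rightarrow> complex) set"

abbreviation points :: "('a, 'm) fspace_scheme \<Rightarrow> 'a set" where
  "points X \<equiv> topspace (Top X)"

definition morphism :: "'a fspace \<Rightarrow> 'b fspace \<Rightarrow> ('a \<Rightarrow> 'b) \<Rightarrow> bool" where
  "morphism X Y f \<longleftrightarrow>
     continuous_map (Top X) (Top Y) f \<and>
     (\<forall>V g. openin (Top Y) V \<longrightarrow> g \<in> Reg Y V \<longrightarrow> g \<circ> f \<in> Reg X {x \<in> points X. f x \<in> V})"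

definition isomorphism :: "'a fspace \<Rightarrow> 'b fspace \<Rightarrow> ('a \<Rightarrow> 'b) \<Rightarrow> bool" where
  "isomorphism X Y f \<longleftrightarrow>
     morphism X Y f \<and>
     (\<exists>g. morphism Y X g \<and> (\<forall>x\<in>points X. g (f x) = x) \<and> (\<forall>y\<in>points Y. f (g y) = y))"

text \<open>
  The reduced structure on a locally closed subset \<open>S\<close>: regular functions on \<open>S\<close> are those which
  locally are restrictions of regular functions of the ambient space.
\<close>

definition subvariety :: "'a fspace \<Rightarrow> 'a set \<Rightarrow> 'a fspace" where
  "subvariety X S =
     \<lparr> Top = subtopology (Top X) S,
       Reg = (\<lambda>U. {f. \<forall>x\<in>U. \<exists>W g. openin (Top X) W \<and> x \<in> W \<and> g \<in> Reg X W \<and>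
                          (\<forall>w \<in> W \<inter> U. f w = g w)}) \<rparr>"

text \<open>Transport of structure along an injection \<open>e\<close>.\<close>

definition transport :: "('a \<Rightarrow> 'b) \<Rightarrow> 'a fspace \<Rightarrow> 'b fspace" where
  "transport e X =
     \<lparr> Top = pullback_topology (range e) (inv e) (Top X),
       Reg = (\<lambda>U. {f. f \<circ> e \<in> Reg X (e -` U)}) \<rparr>"


section \<open>The affine plane and projective spaces\<close>

text \<open>The algebra of functions generated over the complex numbers by a set of functions.\<close>

inductive_set polyfuns :: "('a \<Rightarrow> complex) set \<Rightarrow> ('a \<Rightarrow> complex) set"
  for S :: "('a \<Rightarrow> complex) set" where
  gen: "f \<in> S \<Longrightarrow> f \<in> polyfuns S"
| const: "(\<lambda>_. c) \<in> polyfuns S"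
| add: "f \<in> polyfuns S \<Longrightarrow> g \<in> polyfuns S \<Longrightarrow> (\<lambda>x. f x + g x) \<in> polyfuns S"
| mult: "f \<in> polyfuns S \<Longrightarrow> g \<in> polyfuns S \<Longrightarrow> (\<lambda>x. f x * g x) \<in> polyfuns S"

abbreviation polys2 :: "(complex \<times> complex \<Rightarrow> complex) set" where
  "polys2 \<equiv> polyfuns {fst, snd}"

definition zariski_plane :: "(complex \<times> complex) topology" where
  "zariski_plane = topology_generated_by {{z. F z \<noteq> 0} | F. F \<in> polys2}"

definition plane :: "(complex \<times> complex) fspace" where
  "plane =
     \<lparr> Top = zariski_plane,
       Reg = (\<lambda>U. {f. \<forall>z\<in>U. \<exists>W F G. openin zariski_plane W \<and> z \<in> W \<and> W \<subseteq> U \<and>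
                        F \<in> polys2 \<and> G \<in> polys2 \<and> (\<forall>w\<in>W. G w \<noteq> 0 \<and> f w = F w / G w)}) \<rparr>"

definition proportional :: "complex ^ 'n \<Rightarrow> complex ^ 'n \<Rightarrow> bool" where
  "proportional v w \<longleftrightarrow> v \<noteq> 0 \<and> (\<exists>c. c \<noteq> 0 \<and> w = c *s v)"

lemma part_equivp_proportional: "part_equivp (proportional :: complex ^ 'n \<Rightarrow> _)"
proof (rule part_equivpI)
  have "proportional (1 :: complex ^ 'n) 1"
    by (auto simp: proportional_def intro!: exI[of _ 1])
  then show "\<exists>v. proportional (v :: complex ^ 'n) v" ..
  show "symp (proportional :: complex ^ 'n \<Rightarrow> _)"
  proof (rule sympI)
    fix v w :: "complex ^ 'n" assume "proportional v w"
    then obtain c where c: "v \<noteq> 0" "c \<noteq> 0" "w = c *s v" unfolding proportional_def by blast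
    then have "v = inverse c *s w" by (simp add: vector_smult_assoc)
    moreover have "w \<noteq> 0" "inverse c \<noteq> 0" using c by simp_all
    ultimately show "proportional w v" unfolding proportional_def by blast
  qed
  show "transp (proportional :: complex ^ 'n \<Rightarrow> _)"
  proof (rule transpI)
    fix u v w :: "complex ^ 'n" assume "proportional u v" "proportional v w"
    then obtain c c' where c: "u \<noteq> 0" "c \<noteq> 0" "c' \<noteq> 0" "w = c' *s (c *s u)"
      by (auto simp: proportional_def)
    then have "w = (c' * c) *s u" "c' * c \<noteq> 0" by (simp_all add: vector_smult_assoc)
    with c(1) show "proportional u w" unfolding proportional_def by blast
  qed
qed

text \<open>
  \<open>'n proj\<close> is the projective space of dimension \<open>CARD('n) - 1\<close>, the set of classes
  \<open>abs_proj v\<close> of nonzero vectors \<open>v\<close>.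
\<close>

quotient_type (overloaded) 'n proj = "complex ^ 'n" / partial: "proportional :: complex ^ 'n \<Rightarrow> _"
  by (rule part_equivp_proportional)

definition pt1 :: "complex \<Rightarrow> complex \<Rightarrow> 2 proj" where
  "pt1 x y = abs_proj (vector [x, y])"

definition pt2 :: "complex \<Rightarrow> complex \<Rightarrow> complex \<Rightarrow> 3 proj" where
  "pt2 x y z = abs_proj (vector [x, y, z])"

text \<open>
  Since the field is infinite, a polynomial function is given by a homogeneous polynomial of
  degree \<open>k\<close> iff it is a homogeneous function of degree \<open>k\<close>; the zero polynomial is
  homogeneous of every degree.
\<close>

definition homogeneous :: "nat \<Rightarrow> (complex ^ 'n \<Rightarrow> complex) set" where
  "homogeneous k =
     {F \<in> polyfuns (range (\<lambda>i v. v $ i)). \<forall>c v. F (c *s v) = c ^ k * F v}"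

definition zariski_proj :: "'n::finite proj topology" where
  "zariski_proj =
     topology_generated_by {{abs_proj v | v. v \<noteq> 0 \<and> F v \<noteq> 0} | F. \<exists>k. F \<in> homogeneous k}"

definition proj_space :: "'n::finite proj fspace" where
  "proj_space =
     \<lparr> Top = zariski_proj,
       Reg = (\<lambda>U. {f. \<forall>P\<in>U. \<exists>W k F G. openin zariski_proj W \<and> P \<in> W \<and> W \<subseteq> U \<and>
                        F \<in> homogeneous k \<and> G \<in> homogeneous k \<and>
                        (\<forall>v. v \<noteq> 0 \<longrightarrow> abs_proj v \<in> W \<longrightarrow>
                           G v \<noteq> 0 \<and> f (abs_proj v) = F v / G v)}) \<rparr>"

abbreviation P2 :: "3 proj fspace" where
  "P2 \<equiv> proj_space"

definition emb :: "complex \<times> complex \<Rightarrow> 3 proj" where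
  "emb = (\<lambda>(x, y). pt2 x y 1)"

definition l_inf :: "3 proj set" where
  "l_inf = {pt2 x y 0 | x y. (x, y) \<noteq> (0, 0)}"


section \<open>Blowing up a point of a surface\<close>

text \<open>
  Let \<open>\<phi>\<close> be a coordinate chart of the surface \<open>X\<close>, i.e. an isomorphism of the affine plane
  onto an open subset of \<open>X\<close>, and let \<open>c = (c1, c2)\<close> be the coordinates of the point to
  be blown up. As a set, the blow-up is \<open>X - {\<phi> c}\<close> together with a projective line of new
  points \<open>e [\<alpha>:\<beta>]\<close>, where \<open>e\<close> is an injection into the points not yet used. As a variety it
  is glued from \<open>X - {\<phi> c}\<close> and the blow-up of the plane in \<open>c\<close>, that is
  \<open>{((s, t), [\<alpha>:\<beta>]). (s - c1) * \<beta> = (t - c2) * \<alpha>}\<close>, which in turn is covered by two planes: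
  one with coordinates \<open>(s', m)\<close>, where \<open>s - c1 = s'\<close>, \<open>t - c2 = s' * m\<close>, and one with
  coordinates \<open>(t', n)\<close>, where \<open>t - c2 = t'\<close>, \<open>s - c1 = t' * n\<close>.
\<close>

definition chart_fst ::
  "(complex \<times> complex \<Rightarrow> 'a) \<Rightarrow> complex \<times> complex \<Rightarrow> (2 proj \<Rightarrow> 'a) \<Rightarrow> complex \<times> complex \<Rightarrow> 'a"
where
  "chart_fst \<phi> c e =
     (\<lambda>(s, m). if s = 0 then e (pt1 1 m) else \<phi> (fst c + s, snd c + s * m))"

definition chart_snd ::
  "(complex \<times> complex \<Rightarrow> 'a) \<Rightarrow> complex \<times> complex \<Rightarrow> (2 proj \<Rightarrow> 'a) \<Rightarrow> complex \<times> complex \<Rightarrow> 'a"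
where
  "chart_snd \<phi> c e =
     (\<lambda>(t, n). if t = 0 then e (pt1 n 1) else \<phi> (fst c + t * n, snd c + t))"

definition open_in_blow_up ::
  "'a fspace \<Rightarrow> (complex \<times> complex \<Rightarrow> 'a) \<Rightarrow> complex \<times> complex \<Rightarrow> (2 proj \<Rightarrow> 'a) \<Rightarrow> 'a set \<Rightarrow> bool"
where
  "open_in_blow_up X \<phi> c e V \<longleftrightarrow>
     V \<subseteq> (points X - {\<phi> c}) \<union> range e \<and>
     openin (Top X) (V - range e) \<and>
     openin zariski_plane (chart_fst \<phi> c e -` V) \<and>
     openin zariski_plane (chart_snd \<phi> c e -` V)"

definition blow_up ::
  "'a fspace \<Rightarrow> (complex \<times> complex \<Rightarrow> 'a) \<Rightarrow> complex \<times> complex \<Rightarrow> (2 proj \<Rightarrow> 'a) \<Rightarrow> 'a fspace"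
where
  "blow_up X \<phi> c e =
     \<lparr> Top = topology (open_in_blow_up X \<phi> c e),
       Reg = (\<lambda>V. {f. f \<in> Reg X (V - range e) \<and>
                      f \<circ> chart_fst \<phi> c e \<in> Reg plane (chart_fst \<phi> c e -` V) \<and>
                      f \<circ> chart_snd \<phi> c e \<in> Reg plane (chart_snd \<phi> c e -` V)}) \<rparr>"

lemma openin_blow_up: "openin (Top (blow_up X \<phi> c e)) V \<longleftrightarrow> open_in_blow_up X \<phi> c e V"
proof -
  have "istopology (open_in_blow_up X \<phi> c e)"
    unfolding istopology_def
  proof (intro conjI allI impI)
    fix S T assume *: "open_in_blow_up X \<phi> c e S" "open_in_blow_up X \<phi> c e T"
    have "S \<inter> T - range e = (S - range e) \<inter> (T - range e)" by blast
    with * show "open_in_blow_up X \<phi> c e (S \<inter> T)"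
      unfolding open_in_blow_up_def vimage_Int by (metis openin_Int inf.coboundedI1)
  next
    fix K assume K: "\<forall>V\<in>K. open_in_blow_up X \<phi> c e V"
    have "openin (Top X) (\<Union>V\<in>K. V - range e)"
      using K by (intro openin_Union) (auto simp only: open_in_blow_up_def)
    moreover have "\<Union>K - range e = (\<Union>V\<in>K. V - range e)" by blast
    moreover have "openin zariski_plane (\<Union>V\<in>K. chart_fst \<phi> c e -` V)"
      using K by (intro openin_Union) (auto simp only: open_in_blow_up_def)
    moreover have "openin zariski_plane (\<Union>V\<in>K. chart_snd \<phi> c e -` V)"
      using K by (intro openin_Union) (auto simp only: open_in_blow_up_def)
    moreover have "\<Union>K \<subseteq> (points X - {\<phi> c}) \<union> range e"
      using K unfolding open_in_blow_up_def by (intro Union_least) blast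
    ultimately show "open_in_blow_up X \<phi> c e (\<Union>K)"
      unfolding open_in_blow_up_def vimage_Union by metis
  qed
  then show ?thesis
    unfolding blow_up_def by simp
qed


section \<open>The surface attached to a Henon map\<close>

definition henon :: "complex poly \<Rightarrow> complex \<Rightarrow> complex \<times> complex \<Rightarrow> complex \<times> complex" where
  "henon p a = (\<lambda>(x, y). (poly p x - a * y, x))"

text \<open>\<open>reflect_poly p\<close> is the polynomial \<open>q(X) = X ^ d * p (1 / X)\<close>, where \<open>d = degree p\<close>:\<close>

lemma "poly (reflect_poly p) x = x ^ degree p * poly p (1 / x)" if "x \<noteq> 0" for x :: complex
  using poly_reflect_poly_nz[OF that, of p] by (simp add: inverse_eq_divide)

primrec q_seq :: "complex poly \<Rightarrow> nat \<Rightarrow> complex poly" where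
  "q_seq p 0 = reflect_poly p"
| "q_seq p (Suc k) = (q_seq p k - [:poly (q_seq p k) 0:]) div [:0, 1:]"

fun Q_seq :: "complex poly \<Rightarrow> nat \<Rightarrow> complex" where
  "Q_seq p 0 = 1"
| "Q_seq p (Suc k) = - (\<Sum>j\<in>{0..k}. Q_seq p j * poly (q_seq p (k - j + 1)) 0)"

text \<open>
  Points of the surfaces in the tower: \<open>Base P\<close> is a point of the projective plane and
  \<open>Exc n l\<close> is the point with direction \<open>l\<close> on the exceptional curve of the \<open>n\<close>-th blow-up,
  where blow-ups are counted from 1.
\<close>

datatype point = Base "3 proj" | Exc nat "2 proj"

text \<open>
  \<open>center p a n\<close> is the center of the \<open>(n + 1)\<close>-st blow-up, in the coordinates \<open>coords p a n\<close>
  available after \<open>n\<close> blow-ups. With \<open>d = degree p\<close>, these coordinates are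
  \<open>(u, v)\<close> for \<open>n = 0\<close>, \<open>(u, X_1)\<close> for \<open>n = 1\<close>, \<open>(X_1, X_n)\<close> for \<open>2 \<le> n \<le> d\<close>, and
  \<open>(X_1, Y_(n - d))\<close> for \<open>d \<le> n \<le> 2 * d - 1\<close>. Only in the second blow-up, \<open>u = X_1 * X_2\<close>, is
  it the second coordinate that is kept.
\<close>

definition center :: "complex poly \<Rightarrow> complex \<Rightarrow> nat \<Rightarrow> complex \<times> complex" where
  "center p a n = (0, if n < degree p then 0 else a * Q_seq p (n - degree p))"

primrec coords :: "complex poly \<Rightarrow> complex \<Rightarrow> nat \<Rightarrow> complex \<times> complex \<Rightarrow> point" where
  "coords p a 0 = (\<lambda>(u, v). Base (pt2 u 1 v))"
| "coords p a (Suc n) =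
     (if n = 1 then chart_snd else chart_fst) (coords p a n) (center p a n) (Exc (Suc n))"

primrec surface :: "complex poly \<Rightarrow> complex \<Rightarrow> nat \<Rightarrow> point fspace" where
  "surface p a 0 = transport Base P2"
| "surface p a (Suc n) = blow_up (surface p a n) (coords p a n) (center p a n) (Exc (Suc n))"

definition X_tilde :: "complex poly \<Rightarrow> complex \<Rightarrow> point fspace" where
  "X_tilde p a = surface p a (2 * degree p - 1)"

definition D_tilde :: "complex poly \<Rightarrow> complex \<Rightarrow> point set" where
  "D_tilde p a = points (X_tilde p a) - range (\<lambda>z. Base (emb z))"

definition last_exceptional :: "complex poly \<Rightarrow> point set" where
  "last_exceptional p = range (Exc (2 * degree p - 1))"

end

theory Submission
  imports Defs
begin

text \<open>
  At every stage of the tower the map has at most one point of indeterminacy, the center of the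
  next blow-up. In the coordinates \<open>(X, Y)\<close> around it the map is given by three polynomials whose
  only common zero is the center; pulled back to either chart of the blow-up they acquire a power
  of the exceptional coordinate as a common factor. After removing it, the second and third
  polynomials still vanish on the exceptional curve, except at the last stage, so the curve is
  contracted to \<open>[1:0:0]\<close>, while the first polynomial vanishes there only at the next center. For
  the centers \<open>a Q_k\<close> this rests on the identity \<open>a Q_k q + S_k = X S_{k+1}\<close>, where \<open>S_0 = -a\<close> and
  \<open>S_k = a (Q_0 q_k + ... + Q_{k-1} q_1)\<close> for \<open>k \<ge> 1\<close>, together with \<open>S_k(0) = - a Q_k\<close>. On the last
  exceptional curve the map is \<open>[\<alpha>:\<beta>] \<mapsto> [\<beta> - a Q_{d-1} \<alpha> : a \<alpha> : 0]\<close>.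
\<close>

text \<open>In the coordinates of the tower X_1 = 1/x and Y_0 = x^d/y, so Y_0 q(X_1) = p(x)/y. After
  division by y the map reads [Y_0 q(X) - a : X^(d-1) Y_0 : X^d Y_0]. Its first entry vanishes on
  the curve p(x) = a y, which near infinity is the graph Y_0 = a/q(X). Since q_k(0) is the
  coefficient of X^k in q, the recursion for Q_k is the one for the power series 1/q; the centers a
  Q_k thus follow the expansion of a/q, that is, the branch of that curve at infinity. Along this
  branch Y_0 = a at X = 0, so the second entry vanishes to order d - 1, and d - 1 blow-ups use up
  this order. A blow-up keeps the names of the surviving points, so a single total function
  \<open>H_ext\<close> serves all stages; its values at the centers carry no meaning, and statements
  about a stage are made off \<open>indeterminacy\<close>. Regularity on a blow-up is defined
  through both charts, so the chart that the tower abandons has to be computed at every stage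
  too.\<close>

no_notation fps_nth (infixl \<open>$\<close> 75)

section \<open>Algebras of polynomial functions\<close>

lemma polyfuns_uminus: "f \<in> polyfuns S \<Longrightarrow> (\<lambda>x. - f x) \<in> polyfuns S"
  using polyfuns.mult[OF polyfuns.const[of "-1"], of f S] by simp

lemma polyfuns_diff: "f \<in> polyfuns S \<Longrightarrow> g \<in> polyfuns S \<Longrightarrow> (\<lambda>x. f x - g x) \<in> polyfuns S"
  using polyfuns.add[OF _ polyfuns_uminus, of f S g] by simp

lemma polyfuns_power: "f \<in> polyfuns S \<Longrightarrow> (\<lambda>x. f x ^ n) \<in> polyfuns S"
  by (induction n) (auto intro: polyfuns.intros)

lemma polyfuns_sum:
  "(\<And>i. i \<in> I \<Longrightarrow> f i \<in> polyfuns S) \<Longrightarrow> (\<lambda>x. \<Sum>i\<in>I. f i x) \<in> polyfuns S"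
  by (induction I rule: infinite_finite_induct) (auto intro: polyfuns.intros)

lemma polyfuns_poly: "f \<in> polyfuns S \<Longrightarrow> (\<lambda>x. poly p (f x)) \<in> polyfuns S"
  by (induction p) (auto intro: polyfuns.intros)

lemmas polyfuns_intros =
  polyfuns.const polyfuns.add polyfuns.mult polyfuns_uminus polyfuns_diff polyfuns_power
  polyfuns_sum polyfuns_poly

lemma polyfuns_comp:
  assumes "F \<in> polyfuns S" and "\<And>g. g \<in> S \<Longrightarrow> (\<lambda>x. g (h x)) \<in> polyfuns T"
  shows "(\<lambda>x. F (h x)) \<in> polyfuns T"
  using assms(1) by induction (auto intro: polyfuns.intros assms(2))

lemma fst_in_polys2 [intro, simp]: "fst \<in> polys2" and snd_in_polys2 [intro, simp]: "snd \<in> polys2"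
  by (auto intro: polyfuns.gen)

abbreviation coord_polys :: "(complex ^ 'n \<Rightarrow> complex) set" where
  "coord_polys \<equiv> polyfuns (range (\<lambda>i v. v $ i))"

lemma coord_polys_comp:
  fixes T :: "'a \<Rightarrow> complex ^ 'n"
  assumes "F \<in> coord_polys" and "\<And>i. (\<lambda>w. T w $ i) \<in> polyfuns S"
  shows "(\<lambda>w. F (T w)) \<in> polyfuns S"
  by (rule polyfuns_comp[OF assms(1)]) (use assms(2) in auto)

lemma component_homogeneous: "(\<lambda>v. v $ i) \<in> homogeneous 1"
  by (auto simp: homogeneous_def intro: polyfuns.gen)

lemma homogeneousD:
  "F \<in> homogeneous k \<Longrightarrow> F \<in> coord_polys" "F \<in> homogeneous k \<Longrightarrow> F (c *s v) = c ^ k * F v"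
  by (auto simp: homogeneous_def)

lemma homogeneous_mult:
  "F \<in> homogeneous k \<Longrightarrow> G \<in> homogeneous l \<Longrightarrow> (\<lambda>v. F v * G v) \<in> homogeneous (k + l)"
  by (auto simp: homogeneous_def power_add intro: polyfuns.intros)

lemma homogeneous_add:
  "F \<in> homogeneous k \<Longrightarrow> G \<in> homogeneous k \<Longrightarrow> (\<lambda>v. F v + G v) \<in> homogeneous k"
  by (auto simp: homogeneous_def algebra_simps intro: polyfuns.intros)

lemma homogeneous_const: "(\<lambda>v. c) \<in> homogeneous 0"
  by (auto simp: homogeneous_def intro: polyfuns.intros)

lemma homogeneous_smult: "F \<in> homogeneous k \<Longrightarrow> (\<lambda>v. c * F v) \<in> homogeneous k"
  using homogeneous_mult[OF homogeneous_const] by fastforce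

lemma homogeneous_power: "F \<in> homogeneous k \<Longrightarrow> (\<lambda>v. F v ^ n) \<in> homogeneous (k * n)"
  by (induction n) (auto intro: homogeneous_const homogeneous_mult)

lemma homogeneous_comp:
  fixes T :: "complex ^ 'm \<Rightarrow> complex ^ 'n"
  assumes F: "F \<in> homogeneous k" and T: "\<And>i. (\<lambda>v. T v $ i) \<in> homogeneous l"
  shows "(\<lambda>v. F (T v)) \<in> homogeneous (l * k)"
proof -
  have "T (c *s v) = c ^ l *s T v" for c v
    using T by (simp add: vec_eq_iff homogeneous_def)
  then show ?thesis
    using coord_polys_comp[OF homogeneousD(1)[OF F], of T] T F
    by (auto simp: homogeneous_def power_mult)
qed


section \<open>Projective spaces and Zariski topologies\<close>

lemma vector2_eq_0_iff [simp]: "vector [x, y] = (0 :: complex ^ 2) \<longleftrightarrow> x = 0 \<and> y = 0"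
  by (simp add: vec_eq_iff forall_2)

lemma vector3_eq_0_iff [simp]: "vector [x, y, z] = (0 :: complex ^ 3) \<longleftrightarrow> x = 0 \<and> y = 0 \<and> z = 0"
  by (simp add: vec_eq_iff forall_3)

lemma smult_vector2: "c *s vector [x, y] = (vector [c * x, c * y] :: complex ^ 2)"
  by (simp add: vec_eq_iff forall_2)

lemma smult_vector3: "c *s vector [x, y, z] = (vector [c * x, c * y, c * z] :: complex ^ 3)"
  by (simp add: vec_eq_iff forall_3)

lemma proportional_refl: "proportional v v \<longleftrightarrow> v \<noteq> 0"
  by (auto simp: proportional_def intro: exI[of _ 1])

lemma abs_proj_eq_iff:
  assumes "v \<noteq> 0" "w \<noteq> 0"
  shows "abs_proj v = abs_proj w \<longleftrightarrow> (\<exists>c. c \<noteq> 0 \<and> w = c *s v)"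
  using Quotient3_rel[OF Quotient3_proj, of v w] assms
  by (simp add: proportional_refl) (simp add: proportional_def)

lemma abs_proj_smult: "v \<noteq> 0 \<Longrightarrow> c \<noteq> 0 \<Longrightarrow> abs_proj (c *s v) = abs_proj v"
  by (subst eq_commute, subst abs_proj_eq_iff) auto

lemma rep_proj_nonzero: "rep_proj P \<noteq> 0"
  using Quotient3_rep_reflp[OF Quotient3_proj, of P] by (simp add: proportional_refl)

lemma abs_rep_proj: "abs_proj (rep_proj P) = P"
  using Quotient3_abs_rep[OF Quotient3_proj] .

lemma proj_cases: obtains v where "v \<noteq> 0" "P = abs_proj v"
  using abs_rep_proj rep_proj_nonzero by metis

lemma pt2_eq_abs_proj: "abs_proj v = pt2 (v $ 1) (v $ 2) (v $ 3)" for v :: "complex ^ 3"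
  unfolding pt2_def by (rule arg_cong[of _ _ abs_proj]) (simp add: vec_eq_iff forall_3)

lemma pt1_eq_abs_proj: "abs_proj v = pt1 (v $ 1) (v $ 2)" for v :: "complex ^ 2"
  unfolding pt1_def by (rule arg_cong[of _ _ abs_proj]) (simp add: vec_eq_iff forall_2)

lemma pt1_cases: obtains x y where "(x, y) \<noteq> (0, 0)" "P = pt1 x y"
proof -
  obtain v where "v \<noteq> 0" "P = abs_proj v" by (rule proj_cases)
  then show ?thesis using that[of "v $ 1" "v $ 2"] by (auto simp: pt1_eq_abs_proj vec_eq_iff forall_2)
qed

lemma pt2_cases: obtains x y z where "(x, y, z) \<noteq> (0, 0, 0)" "P = pt2 x y z"
proof -
  obtain v where "v \<noteq> 0" "P = abs_proj v" by (rule proj_cases)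
  then show ?thesis
    using that[of "v $ 1" "v $ 2" "v $ 3"] by (auto simp: pt2_eq_abs_proj vec_eq_iff forall_3)
qed

lemma pt1_eq_iff:
  assumes "(x, y) \<noteq> (0, 0)" "(x', y') \<noteq> (0, 0)"
  shows "pt1 x y = pt1 x' y' \<longleftrightarrow> (\<exists>c. c \<noteq> 0 \<and> x' = c * x \<and> y' = c * y)"
  using assms unfolding pt1_def
  by (subst abs_proj_eq_iff) (auto simp: smult_vector2 vec_eq_iff forall_2)

lemma pt1_div_right: "y \<noteq> 0 \<Longrightarrow> pt1 x y = pt1 (x / y) 1"
  by (subst pt1_eq_iff) (auto intro!: exI[of _ "inverse y"] simp: field_simps)

lemma pt1_affine_eq_iff [simp]:
  "pt1 1 m = pt1 1 n \<longleftrightarrow> m = n" "pt1 m 1 = pt1 n 1 \<longleftrightarrow> m = n"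
  "pt1 m 1 = pt1 1 n \<longleftrightarrow> m * n = 1" "pt1 1 m = pt1 n 1 \<longleftrightarrow> m * n = 1"
  by (auto simp: pt1_eq_iff mult.commute intro: exI[of _ m] exI[of _ n])

lemma pt2_eq_iff:
  assumes "(x, y, z) \<noteq> (0, 0, 0)" "(x', y', z') \<noteq> (0, 0, 0)"
  shows "pt2 x y z = pt2 x' y' z' \<longleftrightarrow> (\<exists>c. c \<noteq> 0 \<and> x' = c * x \<and> y' = c * y \<and> z' = c * z)"
  using assms unfolding pt2_def
  by (subst abs_proj_eq_iff) (auto simp: smult_vector3 vec_eq_iff forall_3)

section \<open>Basic open sets of the Zariski topologies, and closedness of points\<close>

lemma openin_topology_generated_by_base:
  assumes inter: "\<And>A B. A \<in> \<B> \<Longrightarrow> B \<in> \<B> \<Longrightarrow> A \<inter> B \<in> \<B>" and cover: "UNIV \<in> \<B>"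
  shows "openin (topology_generated_by \<B>) U \<longleftrightarrow> (\<forall>x\<in>U. \<exists>B\<in>\<B>. x \<in> B \<and> B \<subseteq> U)"
proof
  assume "openin (topology_generated_by \<B>) U"
  then have "generate_topology_on \<B> U" by (simp add: openin_topology_generated_by_iff)
  then show "\<forall>x\<in>U. \<exists>B\<in>\<B>. x \<in> B \<and> B \<subseteq> U"
  proof induction
    case (Int A B)
    show ?case
    proof
      fix x assume "x \<in> A \<inter> B"
      then obtain A' B' where "A' \<in> \<B>" "x \<in> A'" "A' \<subseteq> A" "B' \<in> \<B>" "x \<in> B'" "B' \<subseteq> B"
        using Int.IH by blast
      then show "\<exists>C\<in>\<B>. x \<in> C \<and> C \<subseteq> A \<inter> B"
        by (intro bexI[of _ "A' \<inter> B'"]) (auto intro: inter)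
    qed
  next
    case (UN K)
    then show ?case by (meson UnionE Union_upper order_trans)
  qed auto
next
  assume *: "\<forall>x\<in>U. \<exists>B\<in>\<B>. x \<in> B \<and> B \<subseteq> U"
  have "U = \<Union>{B \<in> \<B>. B \<subseteq> U}" using * by blast
  moreover have "openin (topology_generated_by \<B>) (\<Union>{B \<in> \<B>. B \<subseteq> U})"
    by (intro openin_Union) (auto intro: topology_generated_by_Basis)
  ultimately show "openin (topology_generated_by \<B>) U" by simp
qed

lemma openin_zariski_plane:
  "openin zariski_plane U \<longleftrightarrow> (\<forall>z\<in>U. \<exists>F\<in>polys2. F z \<noteq> 0 \<and> (\<forall>w. F w \<noteq> 0 \<longrightarrow> w \<in> U))"
proof -
  let ?B = "{{z. F z \<noteq> 0} | F. F \<in> polys2}"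
  have "A \<inter> B \<in> ?B" if "A \<in> ?B" "B \<in> ?B" for A B
  proof -
    obtain F G where "F \<in> polys2" "G \<in> polys2" "A = {z. F z \<noteq> 0}" "B = {z. G z \<noteq> 0}"
      using \<open>A \<in> ?B\<close> \<open>B \<in> ?B\<close> by blast
    then have "A \<inter> B = {z. F z * G z \<noteq> 0}" "(\<lambda>z. F z * G z) \<in> polys2"
      by (auto intro: polyfuns.mult)
    then show ?thesis by (intro CollectI exI[of _ "\<lambda>z. F z * G z"] conjI)
  qed
  moreover have "UNIV \<in> ?B"
    using polyfuns.const[of 1] by (intro CollectI exI[of _ "\<lambda>_. 1"] conjI) auto
  ultimately have "openin (topology_generated_by ?B) U \<longleftrightarrow> (\<forall>x\<in>U. \<exists>B\<in>?B. x \<in> B \<and> B \<subseteq> U)"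
    by (rule openin_topology_generated_by_base)
  moreover have "(\<exists>B\<in>?B. x \<in> B \<and> B \<subseteq> U) \<longleftrightarrow> (\<exists>F\<in>polys2. F x \<noteq> 0 \<and> {w. F w \<noteq> 0} \<subseteq> U)" for x
    by blast
  ultimately show ?thesis unfolding zariski_plane_def by (simp add: subset_iff)
qed

text \<open>Homogeneity makes the vanishing of \<open>F\<close> independent of the representative,
  so membership in a basic open set can be read off from any nonzero vector over the point.\<close>

lemma abs_proj_in_nonvanishing_iff:
  assumes "v \<noteq> 0" "F \<in> homogeneous k"
  shows "abs_proj v \<in> {abs_proj v | v. v \<noteq> 0 \<and> F v \<noteq> 0} \<longleftrightarrow> F v \<noteq> 0"
proof
  assume "abs_proj v \<in> {abs_proj v | v. v \<noteq> 0 \<and> F v \<noteq> 0}"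
  then obtain w where "w \<noteq> 0" "F w \<noteq> 0" "abs_proj v = abs_proj w" by blast
  then obtain c where "c \<noteq> 0" "w = c *s v" using abs_proj_eq_iff assms(1) by blast
  then show "F v \<noteq> 0" using \<open>F w \<noteq> 0\<close> homogeneousD(2)[OF assms(2)] by auto
qed (use assms in blast)

lemma openin_zariski_proj:
  "openin zariski_proj U \<longleftrightarrow>
     (\<forall>v. v \<noteq> 0 \<longrightarrow> abs_proj v \<in> U \<longrightarrow>
        (\<exists>k. \<exists>F\<in>homogeneous k. F v \<noteq> 0 \<and> (\<forall>w. w \<noteq> 0 \<longrightarrow> F w \<noteq> 0 \<longrightarrow> abs_proj w \<in> U)))"
proof -
  define D :: "(complex ^ 'a \<Rightarrow> complex) \<Rightarrow> 'a proj set"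
    where "D F = {abs_proj v | v. v \<noteq> 0 \<and> F v \<noteq> 0}" for F
  let ?B = "{D F | F. \<exists>k. F \<in> homogeneous k}"
  have "A \<inter> B \<in> ?B" if "A \<in> ?B" "B \<in> ?B" for A B
  proof -
    obtain F G k l where FG: "F \<in> homogeneous k" "G \<in> homogeneous l" "A = D F" "B = D G"
      using \<open>A \<in> ?B\<close> \<open>B \<in> ?B\<close> by blast
    have "P \<in> A \<inter> B \<longleftrightarrow> P \<in> D (\<lambda>v. F v * G v)" for P
    proof -
      obtain v where "v \<noteq> 0" "P = abs_proj v" by (rule proj_cases)
      then show ?thesis
        using FG abs_proj_in_nonvanishing_iff[OF _ FG(1)] abs_proj_in_nonvanishing_iff[OF _ FG(2)]
          abs_proj_in_nonvanishing_iff[OF _ homogeneous_mult[OF FG(1,2)]]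
        unfolding D_def by simp
    qed
    then have "A \<inter> B = D (\<lambda>v. F v * G v)" by blast
    then show ?thesis
      using homogeneous_mult[OF FG(1,2)] by (intro CollectI exI[of _ "\<lambda>v. F v * G v"] conjI exI)
  qed
  moreover have "UNIV \<in> ?B"
  proof -
    have "P \<in> D (\<lambda>_. 1)" for P
      by (rule proj_cases[of P]) (auto simp: D_def)
    then have "UNIV = D (\<lambda>_. 1)" by blast
    then show ?thesis
      using homogeneous_const by (intro CollectI exI[of _ "\<lambda>_. 1"] conjI exI)
  qed
  ultimately have *: "openin (topology_generated_by ?B) U \<longleftrightarrow> (\<forall>x\<in>U. \<exists>B\<in>?B. x \<in> B \<and> B \<subseteq> U)"
    by (rule openin_topology_generated_by_base)
  have "(\<exists>B\<in>?B. abs_proj v \<in> B \<and> B \<subseteq> U) \<longleftrightarrow>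
      (\<exists>k. \<exists>F\<in>homogeneous k. F v \<noteq> 0 \<and> (\<forall>w. w \<noteq> 0 \<longrightarrow> F w \<noteq> 0 \<longrightarrow> abs_proj w \<in> U))"
    if v: "v \<noteq> 0" for v
  proof
    assume "\<exists>B\<in>?B. abs_proj v \<in> B \<and> B \<subseteq> U"
    then obtain F k where F: "F \<in> homogeneous k" "abs_proj v \<in> D F" "D F \<subseteq> U" by blast
    then have "F v \<noteq> 0" using abs_proj_in_nonvanishing_iff[OF v] by (simp add: D_def)
    moreover have "\<forall>w. w \<noteq> 0 \<longrightarrow> F w \<noteq> 0 \<longrightarrow> abs_proj w \<in> U" using F(3) by (auto simp: D_def)
    ultimately show "\<exists>k. \<exists>F\<in>homogeneous k. F v \<noteq> 0 \<and>
        (\<forall>w. w \<noteq> 0 \<longrightarrow> F w \<noteq> 0 \<longrightarrow> abs_proj w \<in> U)"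
      using F(1) by blast
  next
    assume "\<exists>k. \<exists>F\<in>homogeneous k. F v \<noteq> 0 \<and> (\<forall>w. w \<noteq> 0 \<longrightarrow> F w \<noteq> 0 \<longrightarrow> abs_proj w \<in> U)"
    then obtain k F where F: "F \<in> homogeneous k" "F v \<noteq> 0"
      "\<forall>w. w \<noteq> 0 \<longrightarrow> F w \<noteq> 0 \<longrightarrow> abs_proj w \<in> U" by blast
    then have "abs_proj v \<in> D F" "D F \<subseteq> U" using v by (auto simp: D_def)
    then show "\<exists>B\<in>?B. abs_proj v \<in> B \<and> B \<subseteq> U" using F(1) by blast
  qed
  moreover have "(\<forall>P\<in>U. Q P) \<longleftrightarrow> (\<forall>v. v \<noteq> 0 \<longrightarrow> abs_proj v \<in> U \<longrightarrow> Q (abs_proj v))"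
    for Q :: "'a proj \<Rightarrow> bool"
    using abs_rep_proj rep_proj_nonzero by metis
  ultimately have "openin (topology_generated_by ?B) U \<longleftrightarrow> (\<forall>v. v \<noteq> 0 \<longrightarrow> abs_proj v \<in> U \<longrightarrow>
      (\<exists>k. \<exists>F\<in>homogeneous k. F v \<noteq> 0 \<and> (\<forall>w. w \<noteq> 0 \<longrightarrow> F w \<noteq> 0 \<longrightarrow> abs_proj w \<in> U)))"
    using * by simp
  then show ?thesis unfolding zariski_proj_def D_def .
qed

lemma Top_plane [simp]: "Top plane = zariski_plane"
  by (simp add: plane_def)

lemma Top_proj_space [simp]: "Top proj_space = zariski_proj"
  by (simp add: proj_space_def)

lemma topspace_zariski_plane [simp]: "topspace zariski_plane = UNIV"
proof -
  have "openin zariski_plane UNIV"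
    unfolding openin_zariski_plane using polyfuns.const[of 1] by (intro ballI bexI[of _ "\<lambda>_. 1"]) auto
  then show ?thesis using openin_subset by blast
qed

lemma topspace_zariski_proj [simp]: "topspace zariski_proj = UNIV"
proof -
  have "openin (zariski_proj :: 'a proj topology) UNIV"
    unfolding openin_zariski_proj using homogeneous_const[of 1]
    by (intro allI impI exI[of _ 0] bexI[of _ "\<lambda>_. 1"]) auto
  then show ?thesis using openin_subset by blast
qed

lemma openin_plane_complement_point: "openin zariski_plane (- {c})"
  unfolding openin_zariski_plane
proof
  fix z assume z: "z \<in> - {c}"
  have polys: "(\<lambda>w. fst w - fst c) \<in> polys2" "(\<lambda>w. snd w - snd c) \<in> polys2"
    by (auto intro!: polyfuns_intros)
  show "\<exists>F\<in>polys2. F z \<noteq> 0 \<and> (\<forall>w. F w \<noteq> 0 \<longrightarrow> w \<in> - {c})"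
  proof (cases "fst z = fst c")
    case True
    with z have "snd z \<noteq> snd c" by (auto simp: prod_eq_iff)
    then show ?thesis by (intro bexI[OF _ polys(2)]) auto
  next
    case False
    then show ?thesis by (intro bexI[OF _ polys(1)]) auto
  qed
qed

text \<open>An injective map meets \<open>x\<close> in at most one point of the plane, and points of
  the plane are closed. Applied to charts, this gives closed points on a blow-up.\<close>

lemma openin_plane_inj: "inj f \<Longrightarrow> openin zariski_plane {z. f z \<noteq> x}"
proof (cases "x \<in> range f")
  case True
  then obtain c where "x = f c" by blast
  moreover assume "inj f"
  ultimately have "{z. f z \<noteq> x} = - {c}" by (auto dest: injD)
  then show ?thesis by (simp add: openin_plane_complement_point)
next
  case False
  then have "{z. f z \<noteq> x} = topspace zariski_plane" by auto
  then show ?thesis by (metis openin_topspace)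
qed

text \<open>
  A point \<open>[v]\<close> is the common zero of the linear forms \<open>w $ i * v $ j - w $ j * v $ i\<close>.
\<close>

lemma openin_proj_complement_point: "openin zariski_proj (- {P})"
  unfolding openin_zariski_proj
proof (intro allI impI)
  fix w :: "complex ^ 'a" assume w: "w \<noteq> 0" "abs_proj w \<in> - {P}"
  obtain v where v: "v \<noteq> 0" "P = abs_proj v" by (rule proj_cases)
  obtain j where j: "v $ j \<noteq> 0" using v(1) by (auto simp: vec_eq_iff)
  have "\<exists>i. w $ i * v $ j - w $ j * v $ i \<noteq> 0"
  proof (rule ccontr)
    assume "\<nexists>i. w $ i * v $ j - w $ j * v $ i \<noteq> 0"
    then have eq: "w = (w $ j / v $ j) *s v" using j by (simp add: vec_eq_iff field_simps)
    then have "w $ j / v $ j \<noteq> 0" using w(1) by auto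
    from abs_proj_smult[OF v(1) this] have "abs_proj w = P" unfolding eq[symmetric] v(2)[symmetric] .
    then show False using w(2) by simp
  qed
  then obtain i where i: "w $ i * v $ j - w $ j * v $ i \<noteq> 0" ..
  let ?F = "\<lambda>w. v $ j * w $ i + (- v $ i) * w $ j"
  have F: "?F \<in> homogeneous 1"
    by (intro homogeneous_add homogeneous_smult component_homogeneous)
  moreover have "abs_proj u \<noteq> P" if u: "u \<noteq> 0" "?F u \<noteq> 0" for u
  proof
    assume "abs_proj u = P"
    then obtain c where "u = c *s v" using v u abs_proj_eq_iff[OF v(1) u(1)] by auto
    then show False using u by simp
  qed
  moreover have "?F w \<noteq> 0" using i by (simp add: algebra_simps)
  ultimately show "\<exists>k. \<exists>F\<in>homogeneous k. F w \<noteq> 0 \<and>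
      (\<forall>w. w \<noteq> 0 \<longrightarrow> F w \<noteq> 0 \<longrightarrow> abs_proj w \<in> - {P})"
    by (intro exI[of _ 1] bexI[of _ ?F]) auto
qed


section \<open>Maps that are morphisms on an open subset\<close>

text \<open>Intersecting the preimages with \<open>U\<close> avoids building an open subspace and
  lets a total function take arbitrary values outside \<open>U\<close>, such as at points of
  indeterminacy.\<close>

definition morphism_on :: "'a fspace \<Rightarrow> 'b fspace \<Rightarrow> 'a set \<Rightarrow> ('a \<Rightarrow> 'b) \<Rightarrow> bool" where
  "morphism_on X Y U f \<longleftrightarrow>
     (\<forall>V. openin (Top Y) V \<longrightarrow>
        openin (Top X) {x \<in> U. f x \<in> V} \<and>
        (\<forall>g. g \<in> Reg Y V \<longrightarrow> g \<circ> f \<in> Reg X {x \<in> U. f x \<in> V}))"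

lemma morphism_on_imp_morphism:
  assumes "morphism_on X Y (points X) f" "f ` points X \<subseteq> points Y"
  shows "morphism X Y f"
  using assms unfolding morphism_def morphism_on_def continuous_map by blast

lemma morphism_on_comp:
  assumes f: "morphism_on X Y U f" and g: "morphism_on Y Z UNIV g"
  shows "morphism_on X Z U (g \<circ> f)"
  unfolding morphism_on_def
proof (intro allI impI conjI)
  fix W assume W: "openin (Top Z) W"
  then have V: "openin (Top Y) {y \<in> UNIV. g y \<in> W}" using g by (simp add: morphism_on_def)
  have eq: "{x \<in> U. (g \<circ> f) x \<in> W} = {x \<in> U. f x \<in> {y \<in> UNIV. g y \<in> W}}" by simp
  show "openin (Top X) {x \<in> U. (g \<circ> f) x \<in> W}"
    unfolding eq using f V unfolding morphism_on_def by blast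
  fix h assume "h \<in> Reg Z W"
  then have "h \<circ> g \<in> Reg Y {y \<in> UNIV. g y \<in> W}" using g W by (simp add: morphism_on_def)
  then show "h \<circ> (g \<circ> f) \<in> Reg X {x \<in> U. (g \<circ> f) x \<in> W}"
    unfolding eq comp_assoc[symmetric] using f V unfolding morphism_on_def by blast
qed

text \<open>Regularity on a reduced subvariety is local: near each point some map that is regular on
  the ambient space has to agree with \<open>G\<close> on \<open>S\<close> only. This allows
  \<open>line_inv\<close> to be described by two different ambient maps.\<close>

lemma morphism_subvarieties:
  assumes loc: "\<And>x. x \<in> points X \<inter> S \<Longrightarrow>
      \<exists>U f. x \<in> U \<and> morphism_on X Y U f \<and> (\<forall>w\<in>U \<inter> S. G w = f w)"
    and G: "G ` (points X \<inter> S) \<subseteq> points Y \<inter> T"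
  shows "morphism (subvariety X S) (subvariety Y T) G"
proof -
  have *: "openin (Top (subvariety X S)) {x \<in> points (subvariety X S). G x \<in> V}"
    if V: "openin (Top (subvariety Y T)) V" for V
  proof -
    obtain V0 where V0: "openin (Top Y) V0" "V = V0 \<inter> T"
      using V by (auto simp: subvariety_def openin_subtopology)
    \<comment> \<open>Different points come with different local maps \<open>f\<close>, so the
      ambient open set is assembled as the largest one whose trace on \<open>S\<close> is sent into
      \<open>V0\<close>.\<close>
    define \<U> where "\<U> = {W. openin (Top X) W \<and> (\<forall>x\<in>W \<inter> S. G x \<in> V0)}"
    have "openin (Top X) (\<Union>\<U>)" by (auto simp: \<U>_def)
    moreover have "{x \<in> points (subvariety X S). G x \<in> V} = \<Union>\<U> \<inter> S"
    proof (intro equalityI subsetI)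
      fix x assume "x \<in> {x \<in> points (subvariety X S). G x \<in> V}"
      then have x: "x \<in> points X" "x \<in> S" "G x \<in> V0" by (auto simp: subvariety_def V0)
      then obtain U f where f: "x \<in> U" "morphism_on X Y U f" "\<forall>w\<in>U \<inter> S. G w = f w"
        using loc by blast
      then have "{w \<in> U. f w \<in> V0} \<in> \<U>" using V0(1) by (auto simp: \<U>_def morphism_on_def)
      moreover have "x \<in> {w \<in> U. f w \<in> V0}" using x f by auto
      ultimately show "x \<in> \<Union>\<U> \<inter> S" using x(2) by blast
    next
      fix x assume "x \<in> \<Union>\<U> \<inter> S"
      then obtain W where "openin (Top X) W" "x \<in> W" "x \<in> S" "G x \<in> V0" by (auto simp: \<U>_def)
      then have "x \<in> points X \<inter> S" "G x \<in> V0" using openin_subset by auto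
      then show "x \<in> {x \<in> points (subvariety X S). G x \<in> V}"
        using G by (auto simp: subvariety_def V0)
    qed
    ultimately show ?thesis by (auto simp: subvariety_def openin_subtopology)
  qed
  moreover have "g \<circ> G \<in> Reg (subvariety X S) {x \<in> points (subvariety X S). G x \<in> V}"
    if V: "openin (Top (subvariety Y T)) V" and g: "g \<in> Reg (subvariety Y T) V" for V g
  proof -
    have "\<exists>W h. openin (Top X) W \<and> x \<in> W \<and> h \<in> Reg X W \<and>
        (\<forall>w \<in> W \<inter> {x \<in> points (subvariety X S). G x \<in> V}. (g \<circ> G) w = h w)"
      if x: "x \<in> points X" "x \<in> S" "G x \<in> V" for x
    proof -
      obtain W g0 where W: "openin (Top Y) W" "G x \<in> W" "g0 \<in> Reg Y W" "\<forall>w\<in>W \<inter> V. g w = g0 w"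
        using g x by (auto simp: subvariety_def)
      obtain U f where f: "x \<in> U" "morphism_on X Y U f" "\<forall>w\<in>U \<inter> S. G w = f w"
        using loc x by blast
      have "openin (Top X) {w \<in> U. f w \<in> W}" "g0 \<circ> f \<in> Reg X {w \<in> U. f w \<in> W}"
        using f(2) W(1,3) unfolding morphism_on_def by blast+
      then show ?thesis
        using x f W by (intro exI[of _ "{w \<in> U. f w \<in> W}"] exI[of _ "g0 \<circ> f"])
          (auto simp: subvariety_def)
    qed
    then show ?thesis by (auto simp: subvariety_def)
  qed
  moreover have "G ` points (subvariety X S) \<subseteq> points (subvariety Y T)"
    using G by (simp add: subvariety_def)
  ultimately show ?thesis unfolding morphism_def continuous_map by blast
qed

lemma morphism_on_plane_proj:
  fixes T :: "complex \<times> complex \<Rightarrow> complex ^ 'n::finite"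
  assumes U: "openin zariski_plane U" and T: "\<And>i. (\<lambda>w. T w $ i) \<in> polys2"
    and f: "\<And>w. w \<in> U \<Longrightarrow> T w \<noteq> 0 \<and> f w = abs_proj (T w)"
  shows "morphism_on plane proj_space U f"
proof -
  have op: "openin zariski_plane {w \<in> U. f w \<in> V}" if V: "openin zariski_proj V" for V
    unfolding openin_zariski_plane
  proof
    fix z assume z: "z \<in> {w \<in> U. f w \<in> V}"
    obtain A where A: "A \<in> polys2" "A z \<noteq> 0" "\<And>w. A w \<noteq> 0 \<Longrightarrow> w \<in> U"
      using U z unfolding openin_zariski_plane by blast
    have "T z \<noteq> 0" "abs_proj (T z) \<in> V" using f[of z] z by auto
    then obtain k F where F: "F \<in> homogeneous k" "F (T z) \<noteq> 0"
        "\<And>w. w \<noteq> 0 \<Longrightarrow> F w \<noteq> 0 \<Longrightarrow> abs_proj w \<in> V"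
      using V unfolding openin_zariski_proj by blast
    have "(\<lambda>w. F (T w)) \<in> polys2" using coord_polys_comp[OF homogeneousD(1)[OF F(1)]] T by blast
    \<comment> \<open>The factor \<open>A\<close> confines the basic open set to \<open>U\<close>,
      where \<open>f\<close> is known to be given by \<open>T\<close>.\<close>
    then have "(\<lambda>w. A w * F (T w)) \<in> polys2" using A(1) by (intro polyfuns.mult)
    then show "\<exists>F\<in>polys2. F z \<noteq> 0 \<and> (\<forall>w. F w \<noteq> 0 \<longrightarrow> w \<in> {w \<in> U. f w \<in> V})"
      by (rule bexI[rotated]) (use A F f in auto)
  qed
  have "g \<circ> f \<in> Reg plane {w \<in> U. f w \<in> V}" if g: "g \<in> Reg proj_space V" for V g
  proof -
    have "\<exists>W F G. openin zariski_plane W \<and> z \<in> W \<and> W \<subseteq> {w \<in> U. f w \<in> V} \<and>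
        F \<in> polys2 \<and> G \<in> polys2 \<and> (\<forall>w\<in>W. G w \<noteq> 0 \<and> (g \<circ> f) w = F w / G w)"
      if z: "z \<in> U" "f z \<in> V" for z
    proof -
      obtain W k F G where W: "openin zariski_proj W" "f z \<in> W" "W \<subseteq> V"
          "F \<in> homogeneous k" "G \<in> homogeneous k"
          "\<And>v. v \<noteq> 0 \<Longrightarrow> abs_proj v \<in> W \<Longrightarrow> G v \<noteq> 0 \<and> g (abs_proj v) = F v / G v"
        using g z unfolding proj_space_def by (simp, meson)
      have "(\<lambda>w. F (T w)) \<in> polys2" "(\<lambda>w. G (T w)) \<in> polys2"
        using coord_polys_comp[OF homogeneousD(1)[OF W(4)]]
          coord_polys_comp[OF homogeneousD(1)[OF W(5)]] T by blast+
      then show ?thesis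
        using op[OF W(1)] W f z
        by (intro exI[of _ "{w \<in> U. f w \<in> W}"] exI[of _ "\<lambda>w. F (T w)"] exI[of _ "\<lambda>w. G (T w)"]) auto
    qed
    then show ?thesis by (simp add: plane_def)
  qed
  then show ?thesis using op by (auto simp: morphism_on_def proj_space_def plane_def)
qed

lemma morphism_on_proj_proj:
  fixes T :: "complex ^ 'm::finite \<Rightarrow> complex ^ 'n::finite"
  assumes U: "openin zariski_proj U" and T: "\<And>i. (\<lambda>v. T v $ i) \<in> homogeneous l"
    and f: "\<And>v. v \<noteq> 0 \<Longrightarrow> abs_proj v \<in> U \<Longrightarrow> T v \<noteq> 0 \<and> f (abs_proj v) = abs_proj (T v)"
  shows "morphism_on proj_space proj_space U f"
proof -
  have op: "openin zariski_proj {P \<in> U. f P \<in> V}" if V: "openin zariski_proj V" for V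
    unfolding openin_zariski_proj
  proof (intro allI impI)
    fix z :: "complex ^ 'm" assume z: "z \<noteq> 0" "abs_proj z \<in> {P \<in> U. f P \<in> V}"
    obtain k A where A: "A \<in> homogeneous k" "A z \<noteq> 0" "\<And>w. w \<noteq> 0 \<Longrightarrow> A w \<noteq> 0 \<Longrightarrow> abs_proj w \<in> U"
      using U z unfolding openin_zariski_proj by blast
    have "T z \<noteq> 0" "abs_proj (T z) \<in> V" using f z by auto
    then obtain j F where F: "F \<in> homogeneous j" "F (T z) \<noteq> 0"
        "\<And>w. w \<noteq> 0 \<Longrightarrow> F w \<noteq> 0 \<Longrightarrow> abs_proj w \<in> V"
      using V unfolding openin_zariski_proj by blast
    have "(\<lambda>w. A w * F (T w)) \<in> homogeneous (k + l * j)"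
      by (intro homogeneous_mult homogeneous_comp A F T)
    then show "\<exists>k. \<exists>F\<in>homogeneous k. F z \<noteq> 0 \<and>
        (\<forall>w. w \<noteq> 0 \<longrightarrow> F w \<noteq> 0 \<longrightarrow> abs_proj w \<in> {P \<in> U. f P \<in> V})"
      by (intro exI, rule bexI[rotated]) (use A F f in auto)
  qed
  have "g \<circ> f \<in> Reg proj_space {P \<in> U. f P \<in> V}" if g: "g \<in> Reg proj_space V" for V g
  proof -
    have "\<exists>W k F G. openin zariski_proj W \<and> P \<in> W \<and> W \<subseteq> {P \<in> U. f P \<in> V} \<and>
        F \<in> homogeneous k \<and> G \<in> homogeneous k \<and>
        (\<forall>v. v \<noteq> 0 \<longrightarrow> abs_proj v \<in> W \<longrightarrow> G v \<noteq> 0 \<and> (g \<circ> f) (abs_proj v) = F v / G v)"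
      if P: "P \<in> U" "f P \<in> V" for P
    proof -
      obtain W k F G where W: "openin zariski_proj W" "f P \<in> W" "W \<subseteq> V"
          "F \<in> homogeneous k" "G \<in> homogeneous k"
          "\<And>v. v \<noteq> 0 \<Longrightarrow> abs_proj v \<in> W \<Longrightarrow> G v \<noteq> 0 \<and> g (abs_proj v) = F v / G v"
        using g P unfolding proj_space_def by (simp, meson)
      have "(\<lambda>w. F (T w)) \<in> homogeneous (l * k)" "(\<lambda>w. G (T w)) \<in> homogeneous (l * k)"
        using homogeneous_comp T W by blast+
      then show ?thesis
        using op[OF W(1)] W f P
        by (intro exI[of _ "{P \<in> U. f P \<in> W}"] exI[of _ "l * k"] exI[of _ "\<lambda>w. F (T w)"]
            exI[of _ "\<lambda>w. G (T w)"]) auto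
    qed
    then show ?thesis by (simp add: proj_space_def)
  qed
  then show ?thesis using op by (auto simp: morphism_on_def proj_space_def)
qed

section \<open>Rational maps from projective space to the affine plane\<close>

definition ratio_map :: "(complex ^ 'n \<Rightarrow> complex) \<Rightarrow> (complex ^ 'n \<Rightarrow> complex) \<Rightarrow>
    (complex ^ 'n \<Rightarrow> complex) \<Rightarrow> 'n proj \<Rightarrow> complex \<times> complex" where
  "ratio_map A C B P = (A (rep_proj P) / B (rep_proj P), C (rep_proj P) / B (rep_proj P))"

lemma ratio_map_abs_proj:
  assumes "A \<in> homogeneous k" "C \<in> homogeneous k" "B \<in> homogeneous k" "v \<noteq> 0"
  shows "ratio_map A C B (abs_proj v) = (A v / B v, C v / B v)"
proof -
  have "abs_proj v = abs_proj (rep_proj (abs_proj v))" by (simp add: abs_rep_proj)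
  then obtain c where "c \<noteq> 0" "rep_proj (abs_proj v) = c *s v"
    using abs_proj_eq_iff[OF assms(4) rep_proj_nonzero] by blast
  then show ?thesis using assms by (simp add: ratio_map_def homogeneousD(2))
qed

text \<open>Clearing denominators: two fractions over \<open>B v ^ i\<close> and
  \<open>B v ^ j\<close> are brought over \<open>B v ^ (i + j)\<close>, which raises the degree of
  the numerator to \<open>k * (i + j)\<close>. Polynomials on the plane thereby pull back to
  fractions of degree zero.\<close>

lemma dehomogenize_polys2:
  assumes A: "A \<in> homogeneous k" and C: "C \<in> homogeneous k" and B: "B \<in> homogeneous k"
    and "F \<in> polys2"
  shows "\<exists>j. \<exists>E\<in>homogeneous (k * j). \<forall>v. B v \<noteq> 0 \<longrightarrow> F (A v / B v, C v / B v) = E v / B v ^ j"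
  using assms(4)
proof induction
  case (gen f)
  then show ?case using A C by (intro exI[of _ 1]) auto
next
  case (const c)
  show ?case by (intro exI[of _ 0] bexI[of _ "\<lambda>_. c"]) (auto intro: homogeneous_const)
next
  case (add f g)
  then obtain i E j D where *: "E \<in> homogeneous (k * i)" "D \<in> homogeneous (k * j)"
      "\<forall>v. B v \<noteq> 0 \<longrightarrow> f (A v / B v, C v / B v) = E v / B v ^ i"
      "\<forall>v. B v \<noteq> 0 \<longrightarrow> g (A v / B v, C v / B v) = D v / B v ^ j" by blast
  have "(\<lambda>v. E v * B v ^ j + D v * B v ^ i) \<in> homogeneous (k * (i + j))"
    using homogeneous_add[OF homogeneous_mult[OF *(1) homogeneous_power[OF B, of j]]]
      homogeneous_mult[OF *(2) homogeneous_power[OF B, of i]]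
    by (simp add: distrib_left add.commute)
  then show ?case
    by (intro exI[of _ "i + j"] bexI[of _ "\<lambda>v. E v * B v ^ j + D v * B v ^ i"])
      (use * in \<open>auto simp: field_simps power_add\<close>)
next
  case (mult f g)
  then obtain i E j D where *: "E \<in> homogeneous (k * i)" "D \<in> homogeneous (k * j)"
      "\<forall>v. B v \<noteq> 0 \<longrightarrow> f (A v / B v, C v / B v) = E v / B v ^ i"
      "\<forall>v. B v \<noteq> 0 \<longrightarrow> g (A v / B v, C v / B v) = D v / B v ^ j" by blast
  have "(\<lambda>v. E v * D v) \<in> homogeneous (k * (i + j))"
    using homogeneous_mult[OF *(1,2)] by (simp add: distrib_left)
  then show ?case
    by (intro exI[of _ "i + j"] bexI[of _ "\<lambda>v. E v * D v"])
      (use * in \<open>auto simp: power_add\<close>)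
qed

lemma morphism_on_ratio_map:
  fixes A B C :: "complex ^ 'n::finite \<Rightarrow> complex"
  assumes A: "A \<in> homogeneous k" and C: "C \<in> homogeneous k" and B: "B \<in> homogeneous k"
  shows "morphism_on proj_space plane {abs_proj v | v. v \<noteq> 0 \<and> B v \<noteq> 0} (ratio_map A C B)"
proof -
  let ?U = "{abs_proj v | v. v \<noteq> 0 \<and> B v \<noteq> 0}" and ?M = "ratio_map A C B"
  note M = ratio_map_abs_proj[OF A C B]
  note U = abs_proj_in_nonvanishing_iff[OF _ B]
  note dehom = dehomogenize_polys2[OF A C B]
  have op: "openin zariski_proj {P \<in> ?U. ?M P \<in> V}" if V: "openin zariski_plane V" for V
    unfolding openin_zariski_proj
  proof (intro allI impI)
    fix z :: "complex ^ 'n" assume z: "z \<noteq> 0" "abs_proj z \<in> {P \<in> ?U. ?M P \<in> V}"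
    then have Bz: "B z \<noteq> 0" using U[OF z(1)] by simp
    have "(A z / B z, C z / B z) \<in> V" using z M[OF z(1)] by simp
    then obtain F where F: "F \<in> polys2" "F (A z / B z, C z / B z) \<noteq> 0" "\<And>w. F w \<noteq> 0 \<Longrightarrow> w \<in> V"
      using V unfolding openin_zariski_plane by blast
    obtain j E where E: "E \<in> homogeneous (k * j)"
        "\<And>v. B v \<noteq> 0 \<Longrightarrow> F (A v / B v, C v / B v) = E v / B v ^ j"
      using dehom[OF F(1)] by blast
    \<comment> \<open>\<open>E\<close> alone may be nonzero where \<open>B\<close> vanishes; the
      factor \<open>B\<close> keeps the basic open set inside \<open>?U\<close>.\<close>
    have EB: "(\<lambda>v. E v * B v) \<in> homogeneous (k * j + k)" by (rule homogeneous_mult[OF E(1) B])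
    have "abs_proj w \<in> {P \<in> ?U. ?M P \<in> V}" if w: "w \<noteq> 0" "E w * B w \<noteq> 0" for w
      using U[OF w(1)] M[OF w(1)] F(3) E(2)[of w] w by simp
    moreover have "E z * B z \<noteq> 0" using Bz F(2) E(2)[OF Bz] by auto
    ultimately show "\<exists>k. \<exists>F\<in>homogeneous k. F z \<noteq> 0 \<and>
        (\<forall>w. w \<noteq> 0 \<longrightarrow> F w \<noteq> 0 \<longrightarrow> abs_proj w \<in> {P \<in> ?U. ?M P \<in> V})"
      using EB by (intro exI[of _ "k * j + k"] bexI[of _ "\<lambda>v. E v * B v"]) simp_all
  qed
  have "g \<circ> ?M \<in> Reg proj_space {P \<in> ?U. ?M P \<in> V}" if g: "g \<in> Reg plane V" for V g
  proof -
    have "\<exists>W k F G. openin zariski_proj W \<and> P \<in> W \<and> W \<subseteq> {P \<in> ?U. ?M P \<in> V} \<and>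
        F \<in> homogeneous k \<and> G \<in> homogeneous k \<and>
        (\<forall>v. v \<noteq> 0 \<longrightarrow> abs_proj v \<in> W \<longrightarrow> G v \<noteq> 0 \<and> (g \<circ> ?M) (abs_proj v) = F v / G v)"
      if P: "P \<in> {P \<in> ?U. ?M P \<in> V}" for P
    proof -
      have "?M P \<in> V" using P by simp
      then obtain W F G where W: "openin zariski_plane W" "?M P \<in> W" "W \<subseteq> V" "F \<in> polys2" "G \<in> polys2"
          "\<And>w. w \<in> W \<Longrightarrow> G w \<noteq> 0 \<and> g w = F w / G w"
        using g unfolding plane_def by (simp, meson)
      obtain i D where D: "D \<in> homogeneous (k * i)"
          "\<And>v. B v \<noteq> 0 \<Longrightarrow> F (A v / B v, C v / B v) = D v / B v ^ i"
        using dehom[OF W(4)] by blast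
      obtain j E where E: "E \<in> homogeneous (k * j)"
          "\<And>v. B v \<noteq> 0 \<Longrightarrow> G (A v / B v, C v / B v) = E v / B v ^ j"
        using dehom[OF W(5)] by blast
      \<comment> \<open>The quotient of \<open>D / B ^ i\<close> by \<open>E / B ^ j\<close> is
        cross-multiplied, so that numerator and denominator get the equal degrees required by
        \<open>Reg proj_space\<close>.\<close>
      have hom: "(\<lambda>v. D v * B v ^ j) \<in> homogeneous (k * (i + j))"
          "(\<lambda>v. E v * B v ^ i) \<in> homogeneous (k * (i + j))"
        using homogeneous_mult[OF D(1) homogeneous_power[OF B, of j]]
          homogeneous_mult[OF E(1) homogeneous_power[OF B, of i]]
        by (simp_all add: distrib_left add.commute)
      have "E v * B v ^ i \<noteq> 0 \<and> (g \<circ> ?M) (abs_proj v) = D v * B v ^ j / (E v * B v ^ i)"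
        if v: "v \<noteq> 0" "abs_proj v \<in> {P \<in> ?U. ?M P \<in> W}" for v
      proof -
        have Bv: "B v \<noteq> 0" and "?M (abs_proj v) \<in> W" using v U[OF v(1)] by simp_all
        then have "G (A v / B v, C v / B v) \<noteq> 0"
            "g (?M (abs_proj v)) = F (A v / B v, C v / B v) / G (A v / B v, C v / B v)"
          using W(6)[of "?M (abs_proj v)"] M[OF v(1)] by simp_all
        then show ?thesis using Bv by (simp add: D(2) E(2) field_simps)
      qed
      moreover have "{P \<in> ?U. ?M P \<in> W} \<subseteq> {P \<in> ?U. ?M P \<in> V}" using W(3) by blast
      moreover have "P \<in> {P \<in> ?U. ?M P \<in> W}" using P W(2) by simp
      ultimately show ?thesis using op[OF W(1)] hom by blast
    qed
    then show ?thesis by (simp add: proj_space_def)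
  qed
  then show ?thesis using op by (auto simp: morphism_on_def proj_space_def plane_def)
qed

section \<open>Transport of structure\<close>

lemma points_transport: "inj e \<Longrightarrow> points (transport e X) = e ` points X"
  by (auto simp: transport_def topspace_pullback_topology)

lemma openin_transport: "inj e \<Longrightarrow> openin (Top X) U \<Longrightarrow> openin (Top (transport e X)) (e ` U)"
  by (auto simp: transport_def openin_pullback_topology intro!: exI[of _ U])

lemma Reg_transport: "g \<in> Reg (transport e X) U \<longleftrightarrow> g \<circ> e \<in> Reg X (e -` U)"
  by (simp add: transport_def)

lemma morphism_on_transport:
  assumes "inj e" and f: "morphism_on X Y U (f \<circ> e)"
  shows "morphism_on (transport e X) Y (e ` U) f"
  unfolding morphism_on_def
proof (intro allI impI conjI)
  fix V assume V: "openin (Top Y) V"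
  have eq: "{x \<in> e ` U. f x \<in> V} = e ` {x \<in> U. (f \<circ> e) x \<in> V}" by auto
  have eq': "e -` {x \<in> e ` U. f x \<in> V} = {x \<in> U. (f \<circ> e) x \<in> V}"
    using \<open>inj e\<close> by (auto dest: injD)
  have "openin (Top X) {x \<in> U. (f \<circ> e) x \<in> V}" using f V unfolding morphism_on_def by blast
  then show "openin (Top (transport e X)) {x \<in> e ` U. f x \<in> V}"
    unfolding eq by (rule openin_transport[OF \<open>inj e\<close>])
  fix g assume "g \<in> Reg Y V"
  then have "g \<circ> (f \<circ> e) \<in> Reg X {x \<in> U. (f \<circ> e) x \<in> V}"
    using f V unfolding morphism_on_def by blast
  then show "g \<circ> f \<in> Reg (transport e X) {x \<in> e ` U. f x \<in> V}"
    unfolding Reg_transport eq' comp_assoc .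
qed


section \<open>Charts of a blow-up\<close>

text \<open>Holds by construction: openness and regularity on the blow-up include the corresponding
  condition after pullback along this chart.\<close>

lemma morphism_on_chart_fst: "morphism_on plane (blow_up X \<phi> c e) UNIV (chart_fst \<phi> c e)"
  unfolding morphism_on_def openin_blow_up open_in_blow_up_def
  by (auto simp: blow_up_def plane_def vimage_def)

lemma morphism_on_chart_snd: "morphism_on plane (blow_up X \<phi> c e) UNIV (chart_snd \<phi> c e)"
  unfolding morphism_on_def openin_blow_up open_in_blow_up_def
  by (auto simp: blow_up_def plane_def vimage_def)

text \<open>The properties that each surface of the tower hands on to the next blow-up:
  \<open>closed_points\<close> makes the surface without the center open, and
  \<open>exc_notin\<close> guarantees that the names of the new points are fresh.\<close>

locale blow_up_point =
  fixes X :: "'a fspace" and \<phi> :: "complex \<times> complex \<Rightarrow> 'a" and c :: "complex \<times> complex"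
    and e :: "2 proj \<Rightarrow> 'a"
  assumes inj_coords: "inj \<phi>"
    and coords_in: "\<phi> w \<in> points X"
    and closed_points: "x \<in> points X \<Longrightarrow> openin (Top X) (points X - {x})"
    and inj_exc: "inj e"
    and exc_notin: "e l \<notin> points X"
begin

lemma coords_neq_exc [simp]: "\<phi> w \<noteq> e l" "e l \<noteq> \<phi> w"
  using coords_in exc_notin by metis+

lemma inj_chart_fst: "inj (chart_fst \<phi> c e)"
  unfolding chart_fst_def
  by (rule injI) (auto simp: inj_eq[OF inj_coords] inj_eq[OF inj_exc] pt1_eq_iff split: if_splits)

lemma inj_chart_snd: "inj (chart_snd \<phi> c e)"
  unfolding chart_snd_def
  by (rule injI) (auto simp: inj_eq[OF inj_coords] inj_eq[OF inj_exc] pt1_eq_iff split: if_splits)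

lemma chart_fst_in: "chart_fst \<phi> c e w \<in> (points X - {\<phi> c}) \<union> range e"
  unfolding chart_fst_def
  by (cases w; cases c) (auto simp: coords_in inj_eq[OF inj_coords])

lemma chart_snd_in: "chart_snd \<phi> c e w \<in> (points X - {\<phi> c}) \<union> range e"
  unfolding chart_snd_def
  by (cases w; cases c) (auto simp: coords_in inj_eq[OF inj_coords])

lemma points_minus_exc: "(points X - A) \<union> range e - range e = points X - A"
  using exc_notin by blast

text \<open>\<open>topspace\<close> is the largest open set, so openness of the expected set
  suffices: both charts map into it, and the center is a closed point.\<close>

lemma points_blow_up: "points (blow_up X \<phi> c e) = (points X - {\<phi> c}) \<union> range e"
proof -
  let ?S = "(points X - {\<phi> c}) \<union> range e"
  have "chart_fst \<phi> c e -` ?S = topspace zariski_plane" "chart_snd \<phi> c e -` ?S = topspace zariski_plane"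
    by (intro set_eqI; simp only: vimage_eq topspace_zariski_plane UNIV_I chart_fst_in chart_snd_in)+
  then have "openin zariski_plane (chart_fst \<phi> c e -` ?S)" "openin zariski_plane (chart_snd \<phi> c e -` ?S)"
    by (metis openin_topspace)+
  then have "openin (Top (blow_up X \<phi> c e)) ?S"
    unfolding openin_blow_up open_in_blow_up_def points_minus_exc
    using closed_points[OF coords_in] by blast
  moreover have "points (blow_up X \<phi> c e) \<subseteq> ?S"
    using openin_topspace[of "Top (blow_up X \<phi> c e)"]
    unfolding openin_blow_up open_in_blow_up_def by blast
  ultimately show ?thesis using openin_subset by blast
qed

lemma closed_points_blow_up:
  assumes x: "x \<in> points (blow_up X \<phi> c e)"
  shows "openin (Top (blow_up X \<phi> c e)) (points (blow_up X \<phi> c e) - {x})"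
proof -
  let ?S = "points (blow_up X \<phi> c e) - {x}"
  have "chart_fst \<phi> c e -` ?S = {w. chart_fst \<phi> c e w \<noteq> x}"
    "chart_snd \<phi> c e -` ?S = {w. chart_snd \<phi> c e w \<noteq> x}"
    using chart_fst_in chart_snd_in by (auto simp: points_blow_up)
  then have "openin zariski_plane (chart_fst \<phi> c e -` ?S)" "openin zariski_plane (chart_snd \<phi> c e -` ?S)"
    using openin_plane_inj[OF inj_chart_fst] openin_plane_inj[OF inj_chart_snd] by metis+
  moreover have "openin (Top X) (?S - range e)"
  proof (cases "x \<in> points X")
    case True
    have "?S - range e = (points X - {\<phi> c}) \<inter> (points X - {x})"
      using exc_notin by (auto simp: points_blow_up)
    then show ?thesis using closed_points coords_in True by (metis openin_Int)
  next
    case False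
    then have "?S - range e = points X - {\<phi> c}" using exc_notin by (auto simp: points_blow_up)
    then show ?thesis using closed_points coords_in by metis
  qed
  ultimately show ?thesis
    unfolding openin_blow_up open_in_blow_up_def by (auto simp: points_blow_up)
qed

text \<open>The definition of the blow-up imposes three conditions, on the old surface without the
  center and on the two charts; each is supplied by one assumption. \<open>R\<close> collects the
  points of the new curve where \<open>f\<close> is still indeterminate.\<close>

lemma morphism_on_blow_up:
  assumes f: "morphism_on X Y (points X - {\<phi> c}) f" and R: "R \<subseteq> range e"
    and "fst": "morphism_on plane Y {w. chart_fst \<phi> c e w \<notin> R} (f \<circ> chart_fst \<phi> c e)"
    and "snd": "morphism_on plane Y {w. chart_snd \<phi> c e w \<notin> R} (f \<circ> chart_snd \<phi> c e)"
  shows "morphism_on (blow_up X \<phi> c e) Y (points (blow_up X \<phi> c e) - R) f"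
  unfolding morphism_on_def
proof (intro allI impI conjI)
  fix V assume V: "openin (Top Y) V"
  let ?S = "{x \<in> points (blow_up X \<phi> c e) - R. f x \<in> V}"
  have eq: "?S - range e = {x \<in> points X - {\<phi> c}. f x \<in> V}"
    using R exc_notin by (auto simp: points_blow_up)
  have eq_fst: "chart_fst \<phi> c e -` ?S =
      {w \<in> {w. chart_fst \<phi> c e w \<notin> R}. (f \<circ> chart_fst \<phi> c e) w \<in> V}"
    using chart_fst_in by (auto simp: points_blow_up)
  have eq_snd: "chart_snd \<phi> c e -` ?S =
      {w \<in> {w. chart_snd \<phi> c e w \<notin> R}. (f \<circ> chart_snd \<phi> c e) w \<in> V}"
    using chart_snd_in by (auto simp: points_blow_up)
  have "openin (Top X) (?S - range e)"
    unfolding eq using f V unfolding morphism_on_def by blast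
  moreover have "openin zariski_plane (chart_fst \<phi> c e -` ?S)"
    unfolding eq_fst using "fst" V unfolding morphism_on_def by (simp add: plane_def)
  moreover have "openin zariski_plane (chart_snd \<phi> c e -` ?S)"
    unfolding eq_snd using "snd" V unfolding morphism_on_def by (simp add: plane_def)
  ultimately show "openin (Top (blow_up X \<phi> c e)) ?S"
    unfolding openin_blow_up open_in_blow_up_def points_blow_up by blast
  fix g assume g: "g \<in> Reg Y V"
  have "g \<circ> f \<in> Reg X (?S - range e)"
    unfolding eq using f V g unfolding morphism_on_def by blast
  moreover have "(g \<circ> f) \<circ> chart_fst \<phi> c e \<in> Reg plane (chart_fst \<phi> c e -` ?S)"
    unfolding eq_fst comp_assoc using "fst" V g unfolding morphism_on_def by blast
  moreover have "(g \<circ> f) \<circ> chart_snd \<phi> c e \<in> Reg plane (chart_snd \<phi> c e -` ?S)"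
    unfolding eq_snd comp_assoc using "snd" V g unfolding morphism_on_def by blast
  ultimately show "g \<circ> f \<in> Reg (blow_up X \<phi> c e) ?S" by (simp add: blow_up_def)
qed

text \<open>
  If \<open>f\<close> is given near the center by a vector \<open>T\<close> of polynomials vanishing only there, and the
  total transform of \<open>T\<close> is divisible by a power of the equation of the exceptional curve, then
  the quotient describes \<open>f\<close> wherever it does not vanish on that curve.
\<close>

lemma represented_chart_fst:
  fixes T T' :: "complex \<times> complex \<Rightarrow> complex ^ 'n"
  assumes T: "\<And>w. w \<noteq> c \<Longrightarrow> T w \<noteq> 0 \<and> f (\<phi> w) = abs_proj (T w)"
    and div: "\<And>s m. s \<noteq> 0 \<Longrightarrow> T (fst c + s, snd c + s * m) = s ^ j *s T' (s, m)"
    and exc: "\<And>m. e (pt1 1 m) \<notin> R \<Longrightarrow> T' (0, m) \<noteq> 0 \<and> f (e (pt1 1 m)) = abs_proj (T' (0, m))"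
    and w: "chart_fst \<phi> c e w \<notin> R"
  shows "T' w \<noteq> 0 \<and> f (chart_fst \<phi> c e w) = abs_proj (T' w)"
proof -
  obtain s m where [simp]: "w = (s, m)" by (cases w)
  show ?thesis
  proof (cases "s = 0")
    case True
    then show ?thesis using exc[of m] w by (simp add: chart_fst_def)
  next
    case False
    then have "(fst c + s, snd c + s * m) \<noteq> c" by (auto simp: prod_eq_iff)
    then have *: "s ^ j *s T' (s, m) \<noteq> 0"
        "f (\<phi> (fst c + s, snd c + s * m)) = abs_proj (s ^ j *s T' (s, m))"
      using T[of "(fst c + s, snd c + s * m)"] div[OF False] by auto
    then have "T' (s, m) \<noteq> 0" by auto
    then show ?thesis using * False by (simp add: chart_fst_def abs_proj_smult)
  qed
qed

lemma represented_chart_snd: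
  fixes T T' :: "complex \<times> complex \<Rightarrow> complex ^ 'n"
  assumes T: "\<And>w. w \<noteq> c \<Longrightarrow> T w \<noteq> 0 \<and> f (\<phi> w) = abs_proj (T w)"
    and div: "\<And>t m. t \<noteq> 0 \<Longrightarrow> T (fst c + t * m, snd c + t) = t ^ j *s T' (t, m)"
    and exc: "\<And>m. e (pt1 m 1) \<notin> R \<Longrightarrow> T' (0, m) \<noteq> 0 \<and> f (e (pt1 m 1)) = abs_proj (T' (0, m))"
    and w: "chart_snd \<phi> c e w \<notin> R"
  shows "T' w \<noteq> 0 \<and> f (chart_snd \<phi> c e w) = abs_proj (T' w)"
proof -
  obtain t m where [simp]: "w = (t, m)" by (cases w)
  show ?thesis
  proof (cases "t = 0")
    case True
    then show ?thesis using exc[of m] w by (simp add: chart_snd_def)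
  next
    case False
    then have "(fst c + t * m, snd c + t) \<noteq> c" by (auto simp: prod_eq_iff)
    then have *: "t ^ j *s T' (t, m) \<noteq> 0"
        "f (\<phi> (fst c + t * m, snd c + t)) = abs_proj (t ^ j *s T' (t, m))"
      using T[of "(fst c + t * m, snd c + t)"] div[OF False] by auto
    then have "T' (t, m) \<noteq> 0" by auto
    then show ?thesis using * False by (simp add: chart_snd_def abs_proj_smult)
  qed
qed

lemma morphism_on_blow_up_proj:
  fixes T\<^sub>1 T\<^sub>2 :: "complex \<times> complex \<Rightarrow> complex ^ 'n::finite"
  assumes f: "morphism_on X proj_space (points X - {\<phi> c}) f"
    and R: "R \<subseteq> {x}" "R \<subseteq> range e"
    and polys: "\<And>i. (\<lambda>w. T\<^sub>1 w $ i) \<in> polys2" "\<And>i. (\<lambda>w. T\<^sub>2 w $ i) \<in> polys2"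
    and "fst": "\<And>w. chart_fst \<phi> c e w \<notin> R \<Longrightarrow>
      T\<^sub>1 w \<noteq> 0 \<and> f (chart_fst \<phi> c e w) = abs_proj (T\<^sub>1 w)"
    and "snd": "\<And>w. chart_snd \<phi> c e w \<notin> R \<Longrightarrow>
      T\<^sub>2 w \<noteq> 0 \<and> f (chart_snd \<phi> c e w) = abs_proj (T\<^sub>2 w)"
  shows "morphism_on (blow_up X \<phi> c e) proj_space (points (blow_up X \<phi> c e) - R) f"
proof (rule morphism_on_blow_up[OF f R(2)])
  have *: "openin zariski_plane {w. \<psi> w \<notin> R}" if "inj \<psi>" for \<psi> :: "complex \<times> complex \<Rightarrow> 'a"
  proof (cases "R = {}")
    case True
    then have "{w. \<psi> w \<notin> R} = topspace zariski_plane" by simp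
    then show ?thesis by (metis openin_topspace)
  next
    case False
    then have "R = {x}" using R(1) by blast
    then show ?thesis using openin_plane_inj[OF that, of x] by simp
  qed
  show "morphism_on plane proj_space {w. chart_fst \<phi> c e w \<notin> R} (f \<circ> chart_fst \<phi> c e)"
    by (rule morphism_on_plane_proj[OF *[OF inj_chart_fst] polys(1)]) (use "fst" in auto)
  show "morphism_on plane proj_space {w. chart_snd \<phi> c e w \<notin> R} (f \<circ> chart_snd \<phi> c e)"
    by (rule morphism_on_plane_proj[OF *[OF inj_chart_snd] polys(2)]) (use "snd" in auto)
qed

end


section \<open>The tower of blow-ups\<close>

text \<open>The second conjunct strengthens the induction: the names \<open>Exc k\<close> in use
  have k at most n, so those of the next blow-up are fresh.\<close>

lemma blow_up_point_surface:
  "blow_up_point (surface p a n) (coords p a n) (Exc (Suc n)) \<and>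
   points (surface p a n) \<subseteq> range Base \<union> {Exc k l | k l. k \<le> n}"
proof (induction n)
  case 0
  have inj: "inj Base" by (auto intro: injI)
  have points: "points (surface p a 0) = range Base"
    by (simp add: points_transport[OF inj])
  have "openin (Top (surface p a 0)) (points (surface p a 0) - {Base P})" for P
  proof -
    have eq: "points (surface p a 0) - {Base P} = Base ` (- {P})" unfolding points by auto
    have "openin (Top P2) (- {P})" by (simp add: openin_proj_complement_point)
    then show ?thesis unfolding eq unfolding surface.simps by (rule openin_transport[OF inj])
  qed
  moreover have "inj (coords p a 0)"
    by (rule injI) (auto simp: pt2_eq_iff)
  ultimately show ?case unfolding blow_up_point_def
    by (auto simp: points simp del: surface.simps split: prod.split intro: injI)
next
  case (Suc n)
  interpret blow_up_point "surface p a n" "coords p a n" "center p a n" "Exc (Suc n)"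
    using Suc.IH by blast
  have pts: "points (surface p a (Suc n)) \<subseteq> range Base \<union> {Exc k l | k l. k \<le> Suc n}"
  proof -
    have "points (surface p a (Suc n)) \<subseteq> points (surface p a n) \<union> range (Exc (Suc n))"
      unfolding surface.simps(2) points_blow_up by blast
    moreover have "{Exc k l | k l. k \<le> n} \<union> range (Exc (Suc n)) \<subseteq> {Exc k l | k l. k \<le> Suc n}"
      by auto
    ultimately show ?thesis using Suc.IH by blast
  qed
  moreover have "inj (coords p a (Suc n))"
    unfolding coords.simps(2) by (split if_split) (intro conjI impI inj_chart_fst inj_chart_snd)
  moreover have "coords p a (Suc n) w \<in> points (surface p a (Suc n))" for w
    unfolding coords.simps(2) surface.simps(2) points_blow_up
    by (split if_split) (intro conjI impI chart_fst_in chart_snd_in)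
  moreover have "openin (Top (surface p a (Suc n))) (points (surface p a (Suc n)) - {x})"
    if "x \<in> points (surface p a (Suc n))" for x
    using closed_points_blow_up that unfolding surface.simps(2) by blast
  moreover have "inj (Exc (Suc (Suc n)))" by (auto intro: injI)
  moreover have "Exc (Suc (Suc n)) l \<notin> points (surface p a (Suc n))" for l
  proof -
    have "Exc (Suc (Suc n)) l \<notin> range Base \<union> {Exc k l | k l. k \<le> Suc n}" by auto
    then show ?thesis using pts by blast
  qed
  ultimately show ?case unfolding blow_up_point_def by blast
qed

section \<open>Arithmetic of the q_k and Q_k\<close>

lemma poly_q_seq_Suc: "x * poly (q_seq p (Suc k)) x = poly (q_seq p k) x - poly (q_seq p k) 0"
proof -
  let ?r = "q_seq p k - [:poly (q_seq p k) 0:]"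
  \<comment> \<open>The subtracted constant is the value at 0, so the division by X in
    \<open>q_seq\<close> is exact.\<close>
  have "[:0, 1:] dvd ?r" using poly_eq_0_iff_dvd[of ?r 0] by simp
  then have "?r = [:0, 1:] * q_seq p (Suc k)" by (simp only: q_seq.simps dvd_mult_div_cancel)
  from arg_cong[OF this, of "\<lambda>r. poly r x"] show ?thesis by simp
qed

locale monic_henon =
  fixes p :: "complex poly" and a :: complex
  assumes monic [simp]: "lead_coeff p = 1" and degree_ge: "degree p \<ge> 2" and a_neq: "a \<noteq> 0"
begin

abbreviation d where "d \<equiv> degree p"
abbreviation q where "q \<equiv> poly (reflect_poly p)"
abbreviation Q where "Q \<equiv> Q_seq p"

text \<open>This is z^d p(x/z), written as a sum so that it makes sense at z = 0 as well.\<close>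

definition hom_p :: "complex \<Rightarrow> complex \<Rightarrow> complex" where
  "hom_p x z = (\<Sum>i\<le>d. coeff p i * x ^ i * z ^ (d - i))"

text \<open>
  In the coordinates \<open>(X, Y) = (X_1, Y_k)\<close> one has \<open>Y_0 = Y0 k X Y\<close>, and \<open>Y_0 q(X) - a\<close> equals
  \<open>X ^ k * (Y q(X) + S k X)\<close>.
\<close>

definition S :: "nat \<Rightarrow> complex \<Rightarrow> complex" where
  "S k X = (if k = 0 then - a else a * (\<Sum>j<k. Q j * poly (q_seq p (k - j)) X))"

definition Y0 :: "nat \<Rightarrow> complex \<Rightarrow> complex \<Rightarrow> complex" where
  "Y0 k X Y = (\<Sum>j<k. a * Q j * X ^ j) + X ^ k * Y"

lemma q_0 [simp]: "q 0 = 1"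
  by simp

lemma hom_p_scale: "hom_p (c * x) (c * z) = c ^ d * hom_p x z"
  unfolding hom_p_def sum_distrib_left
proof (rule sum.cong)
  fix i assume "i \<in> {..d}"
  then have "c ^ d = c ^ i * c ^ (d - i)" by (simp flip: power_add)
  then show "coeff p i * (c * x) ^ i * (c * z) ^ (d - i) = c ^ d * (coeff p i * x ^ i * z ^ (d - i))"
    by (simp add: power_mult_distrib)
qed simp

lemma hom_p_1_right: "hom_p x 1 = poly p x"
  by (simp add: hom_p_def poly_altdef)

lemma hom_p_0_right: "hom_p x 0 = x ^ d"
proof -
  have "hom_p x 0 = (\<Sum>i\<le>d. if i = d then x ^ d else 0)"
    unfolding hom_p_def by (rule sum.cong) (use monic in \<open>auto simp: power_0_left\<close>)
  then show ?thesis by simp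
qed

lemma hom_p_1_left: "hom_p 1 z = q z"
proof (cases "z = 0")
  case True
  then show ?thesis by (simp add: hom_p_0_right)
next
  case False
  then have "hom_p 1 z = z ^ d * hom_p (inverse z) 1"
    using hom_p_scale[of z "inverse z" 1] by simp
  then show ?thesis using False by (simp add: hom_p_1_right poly_reflect_poly_nz)
qed

text \<open>The sum in \<open>S (Suc i) 0\<close> is the one in the recursion of
  \<open>Q_seq\<close>. As q(0) = 1, the factor \<open>Y * q X + S k X\<close> therefore vanishes at
  X = 0 exactly for Y = a Q_k, the next center.\<close>

lemma S_0: "S k 0 = - a * Q k"
proof (cases k)
  case (Suc i)
  have "(\<Sum>j<k. Q j * poly (q_seq p (k - j)) 0) = (\<Sum>j\<in>{0..i}. Q j * poly (q_seq p (i - j + 1)) 0)"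
    by (rule sum.cong) (auto simp: Suc Suc_diff_le)
  then show ?thesis by (simp add: S_def Suc)
qed (simp add: S_def)

text \<open>Removing the constant term from q_i leaves X q_{i+1}, and the constant terms add up to
  zero by \<open>S_0\<close>. Consequently the substitution of a Q_k + X Y for Y in
  \<open>Y * q X + S k X\<close> splits off one factor X.\<close>

lemma S_Suc: "a * Q k * q X + S k X = X * S (Suc k) X"
proof -
  have "X * S (Suc k) X = a * (\<Sum>j<Suc k. Q j * (X * poly (q_seq p (Suc (k - j))) X))"
    unfolding S_def by (simp add: sum_distrib_left Suc_diff_le mult_ac del: sum.lessThan_Suc q_seq.simps)
  also have "\<dots> = a * (\<Sum>j<k. Q j * (poly (q_seq p (k - j)) X - poly (q_seq p (k - j)) 0))
      + a * Q k * (q X - 1)"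
    unfolding poly_q_seq_Suc by (simp add: algebra_simps)
  also have "\<dots> = a * (\<Sum>j<k. Q j * poly (q_seq p (k - j)) X)
      - a * (\<Sum>j<k. Q j * poly (q_seq p (k - j)) 0) + a * Q k * (q X - 1)"
    by (simp add: right_diff_distrib sum_subtractf)
  also have "\<dots> = a * Q k * q X + S k X"
    using S_0[of k] by (cases "k = 0") (simp_all add: S_def algebra_simps)
  finally show ?thesis by simp
qed

lemma Y0_Suc: "Y0 k X (a * Q k + X * Y) = Y0 (Suc k) X Y"
  by (simp add: Y0_def algebra_simps)

lemma Y0_0_left: "Y0 k 0 Y = (if k = 0 then Y else a)"
proof (cases k)
  case (Suc i)
  \<comment> \<open>Since \<open>0 ^ 0 = 1\<close>, the term with j = 0 survives; it is a because
    \<open>Q 0 = 1\<close>.\<close>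
  have "(\<Sum>j<k. a * Q j * 0 ^ j) = (\<Sum>j<k. if j = 0 then a else 0)"
    by (rule sum.cong) auto
  then show ?thesis by (simp add: Y0_def Suc del: sum.lessThan_Suc)
qed (simp add: Y0_def)

section \<open>The extended map and its values\<close>

definition hom_henon :: "complex ^ 3 \<Rightarrow> complex ^ 3" where
  "hom_henon v = vector [hom_p (v $ 1) (v $ 3) - a * v $ 2 * v $ 3 ^ (d - 1),
     v $ 1 * v $ 3 ^ (d - 1), v $ 3 ^ d]"

text \<open>Obtained from \<open>T_late (d - 1) 0 Y\<close>, which is [Y - a Q_{d-1} : a : 0], by
  putting Y = beta/alpha and clearing the denominator.\<close>

definition last_exc_map :: "complex ^ 2 \<Rightarrow> complex ^ 3" where
  "last_exc_map v = vector [v $ 2 - a * Q (d - 1) * v $ 1, a * v $ 1, 0]"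

primrec H_ext :: "point \<Rightarrow> 3 proj" where
  "H_ext (Base P) = abs_proj (hom_henon (rep_proj P))"
| "H_ext (Exc n l) = (if n = 2 * d - 1 then abs_proj (last_exc_map (rep_proj l)) else pt2 1 0 0)"

text \<open>\<open>rep_proj\<close> returns an unknown representative; equivariance absorbs the
  scalar, and \<open>F v\<close> must be nonzero for the scaled vectors to define the same
  point.\<close>

lemma abs_proj_equivariant:
  fixes F :: "complex ^ 'm \<Rightarrow> complex ^ 'n"
  assumes F: "\<And>c v. F (c *s v) = c ^ k *s F v" and v: "v \<noteq> 0" "F v \<noteq> 0"
  shows "abs_proj (F (rep_proj (abs_proj v))) = abs_proj (F v)"
proof -
  have "abs_proj v = abs_proj (rep_proj (abs_proj v))" by (simp add: abs_rep_proj)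
  then obtain c where "c \<noteq> 0" "rep_proj (abs_proj v) = c *s v"
    using abs_proj_eq_iff[OF v(1) rep_proj_nonzero] by blast
  then show ?thesis using F v by (simp add: abs_proj_smult)
qed

text \<open>For z = 0 the first entry reduces to x^d, because p is monic and the term with a carries
  a positive power of z. Hence [0:1:0] is the only initial point of indeterminacy.\<close>

lemma hom_henon_neq_0: "hom_henon v \<noteq> 0 \<longleftrightarrow> v $ 1 \<noteq> 0 \<or> v $ 3 \<noteq> 0"
  using degree_ge by (auto simp: hom_henon_def hom_p_0_right power_0_left)

lemma hom_henon_smult: "hom_henon (c *s v) = c ^ d *s hom_henon v"
proof -
  have "c ^ d = c * c ^ (d - 1)" using degree_ge by (simp flip: power_Suc)
  then show ?thesis
    by (simp add: hom_henon_def smult_vector3 hom_p_scale power_mult_distrib algebra_simps)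
qed

lemma H_ext_Base:
  assumes "v \<noteq> 0" "v $ 1 \<noteq> 0 \<or> v $ 3 \<noteq> 0"
  shows "H_ext (Base (abs_proj v)) = abs_proj (hom_henon v)"
  using assms by (simp add: abs_proj_equivariant[OF hom_henon_smult] hom_henon_neq_0)

lemma last_exc_map_neq_0: "v \<noteq> 0 \<Longrightarrow> last_exc_map v \<noteq> 0"
  using a_neq vec_eq_iff[of v 0] by (auto simp: last_exc_map_def forall_2)

lemma H_ext_last:
  assumes "v \<noteq> 0"
  shows "H_ext (Exc (2 * d - 1) (abs_proj v)) = abs_proj (last_exc_map v)"
proof -
  have "last_exc_map (c *s v) = c ^ 1 *s last_exc_map v" for c v
    by (simp add: last_exc_map_def smult_vector3 algebra_simps)
  from abs_proj_equivariant[OF this] show ?thesis using assms by (simp add: last_exc_map_neq_0)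
qed

lemma H_ext_emb: "H_ext (Base (emb z)) = emb (henon p a z)"
  by (cases z) (simp add: emb_def pt2_def H_ext_Base hom_henon_def henon_def hom_p_1_right
      del: H_ext.simps)

lemma H_ext_infinity: "x \<noteq> 0 \<Longrightarrow> H_ext (Base (pt2 x y 0)) = pt2 1 0 0"
  using degree_ge abs_proj_smult[of "vector [1, 0, 0] :: complex ^ 3" "x ^ d"]
  by (simp add: pt2_def H_ext_Base hom_henon_def hom_p_0_right smult_vector3 power_0_left
      del: H_ext.simps)

subsection \<open>Local formulas for the extension\<close>

text \<open>
  \<open>T n\<close> gives the map in the coordinates \<open>coords p a n\<close>, after all common factors have been
  removed (in the second chart, \<open>n = 1\<close>, the coordinates are swapped); \<open>W_mid n\<close>, \<open>W_late k\<close> and \<open>W_first\<close> give it in the other chart of the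
  next blow-up.
\<close>

definition T_mid :: "nat \<Rightarrow> complex \<Rightarrow> complex \<Rightarrow> complex ^ 3" where
  "T_mid n X Y = vector [Y * q X - a * X ^ (d - n), X ^ (d - 1) * Y, X ^ d * Y]"

definition T_late :: "nat \<Rightarrow> complex \<Rightarrow> complex \<Rightarrow> complex ^ 3" where
  "T_late k X Y = vector [Y * q X + S k X, X ^ (d - 1 - k) * Y0 k X Y, X ^ (d - k) * Y0 k X Y]"

definition T :: "nat \<Rightarrow> complex \<times> complex \<Rightarrow> complex ^ 3" where
  "T n w =
     (if n = 0 then hom_henon (vector [fst w, 1, snd w])
      else if n = 1 then T_mid 1 (snd w) (fst w)
      else if n \<le> d then T_mid n (fst w) (snd w)
      else T_late (n - d) (fst w) (snd w))"

definition W_first :: "complex \<Rightarrow> complex \<Rightarrow> complex ^ 3" where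
  "W_first t m = vector [t * poly p m - a, t * m, t]"

definition W_mid :: "nat \<Rightarrow> complex \<Rightarrow> complex \<Rightarrow> complex ^ 3" where
  "W_mid n t m = vector [q (t * m) - a * t ^ (d - Suc n) * m ^ (d - n),
     t ^ (d - 1) * m ^ (d - 1), t ^ d * m ^ d]"

definition W_late :: "nat \<Rightarrow> complex \<Rightarrow> complex \<Rightarrow> complex ^ 3" where
  "W_late k t m = vector [q (t * m) + m * S (Suc k) (t * m),
     t ^ (d - 2 - k) * m ^ (d - 1 - k) * Y0 k (t * m) (a * Q k + t),
     t ^ (d - 1 - k) * m ^ (d - k) * Y0 k (t * m) (a * Q k + t)]"

text \<open>At the switch from X_d to Y_0 the two families of formulas agree: \<open>S 0\<close> is
  - a and \<open>Y0 0 X Y\<close> is Y, so \<open>T_mid d\<close> coincides with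
  \<open>T_late 0\<close>.\<close>

lemma T_add_degree: "T (d + k) w = T_late k (fst w) (snd w)"
  using degree_ge by (cases "k = 0") (auto simp: T_def T_late_def T_mid_def S_def Y0_def)

section \<open>Polynomiality of the local formulas\<close>

lemma vector3_polyfuns:
  assumes "A \<in> polyfuns F" "B \<in> polyfuns F" "C \<in> polyfuns F"
  shows "(\<lambda>w. (vector [A w, B w, C w] :: complex ^ 3) $ i) \<in> polyfuns F"
  using exhaust_3[of i] assms by auto

lemma S_polyfuns: "f \<in> polyfuns F \<Longrightarrow> (\<lambda>w. S k (f w)) \<in> polyfuns F"
  by (cases "k = 0") (auto simp: S_def intro!: polyfuns_intros)

lemma Y0_polyfuns: "f \<in> polyfuns F \<Longrightarrow> g \<in> polyfuns F \<Longrightarrow> (\<lambda>w. Y0 k (f w) (g w)) \<in> polyfuns F"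
  unfolding Y0_def by (auto intro!: polyfuns_intros)

lemma W_first_polys: "(\<lambda>w. W_first (fst w) (snd w) $ i) \<in> polys2"
  unfolding W_first_def by (intro vector3_polyfuns polyfuns_intros fst_in_polys2 snd_in_polys2)

lemma T_mid_polys:
  "f \<in> polyfuns F \<Longrightarrow> g \<in> polyfuns F \<Longrightarrow> (\<lambda>w. T_mid n (f w) (g w) $ i) \<in> polyfuns F"
  unfolding T_mid_def by (intro vector3_polyfuns polyfuns_intros)

lemma W_mid_polys: "(\<lambda>w. W_mid n (fst w) (snd w) $ i) \<in> polys2"
  unfolding W_mid_def by (intro vector3_polyfuns polyfuns_intros fst_in_polys2 snd_in_polys2)

lemma T_late_polys: "(\<lambda>w. T_late k (fst w) (snd w) $ i) \<in> polys2"
  unfolding T_late_def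
  by (intro vector3_polyfuns polyfuns_intros S_polyfuns Y0_polyfuns fst_in_polys2 snd_in_polys2)

lemma W_late_polys: "(\<lambda>w. W_late k (fst w) (snd w) $ i) \<in> polys2"
  unfolding W_late_def
  by (intro vector3_polyfuns polyfuns_intros S_polyfuns Y0_polyfuns fst_in_polys2 snd_in_polys2)

lemma T_polys: "n \<noteq> 0 \<Longrightarrow> (\<lambda>w. T n w $ i) \<in> polys2"
  by (cases "n \<le> d"; cases "n = 1") (simp_all add: T_def T_mid_polys T_late_polys)

text \<open>The multiplicity d - 1 comes from - a v^(d-1), the term of lowest degree at [0:1:0]. In
  later blow-ups the multiplicity is 1, since the first entry contains Y times q(X) with q(0) =
  1.\<close>

lemma T_0_fst: "T 0 (s, s * m) = s ^ (d - 1) *s T 1 (s, m)"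
proof -
  have "s ^ d = s * s ^ (d - 1)" using degree_ge by (simp flip: power_Suc)
  then show ?thesis using hom_p_scale[of s 1 m]
    by (simp add: T_def T_mid_def hom_henon_def hom_p_1_left smult_vector3 algebra_simps)
qed

lemma T_0_snd: "T 0 (t * m, t) = t ^ (d - 1) *s W_first t m"
proof -
  have "t ^ d = t * t ^ (d - 1)" using degree_ge by (simp flip: power_Suc)
  then show ?thesis using hom_p_scale[of t m 1]
    by (simp add: T_def W_first_def hom_henon_def hom_p_1_right smult_vector3 algebra_simps)
qed

lemma T_mid_fst:
  assumes "n < d" shows "T_mid n s (s * m) = s *s T_mid (Suc n) s m"
proof -
  \<comment> \<open>An explicit successor form of \<open>d\<close> removes the truncated
    subtractions from the exponents.\<close>
  obtain r where "d = Suc (n + r)" using assms less_iff_Suc_add by blast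
  then show ?thesis by (simp add: T_mid_def smult_vector3 algebra_simps)
qed

lemma T_mid_snd:
  assumes "n < d" shows "T_mid n (t * m) t = t *s W_mid n t m"
proof -
  obtain r where "d = Suc (n + r)" using assms less_iff_Suc_add by blast
  then show ?thesis by (simp add: T_mid_def W_mid_def smult_vector3 algebra_simps power_mult_distrib)
qed

lemma T_late_fst:
  assumes "k < d - 1" shows "T_late k s (a * Q k + s * m) = s *s T_late (Suc k) s m"
proof -
  obtain r where "d - 1 = Suc (k + r)" using assms less_iff_Suc_add by blast
  then have r: "d = Suc (Suc (k + r))" by linarith
  have "(a * Q k + s * m) * q s + S k s = s * (m * q s + S (Suc k) s)"
    using S_Suc[of k s] by (simp add: algebra_simps)
  then show ?thesis by (simp add: T_late_def smult_vector3 Y0_Suc r Suc_diff_le) (simp add: mult_ac)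
qed

lemma T_late_snd:
  assumes "k < d - 1" shows "T_late k (t * m) (a * Q k + t) = t *s W_late k t m"
proof -
  obtain r where "d - 1 = Suc (k + r)" using assms less_iff_Suc_add by blast
  then have r: "d = Suc (Suc (k + r))" by linarith
  have "(a * Q k + t) * q (t * m) + S k (t * m) = t * (q (t * m) + m * S (Suc k) (t * m))"
    using S_Suc[of k "t * m"] by (simp add: algebra_simps)
  then show ?thesis
    by (simp add: T_late_def W_late_def smult_vector3 r Suc_diff_le power_mult_distrib mult_ac)
qed

lemma abs_proj_q: "x \<noteq> 0 \<Longrightarrow> abs_proj (vector [x, 0, 0]) = pt2 1 0 0"
  using abs_proj_smult[of "vector [1, 0, 0] :: complex ^ 3" x] by (simp add: pt2_def smult_vector3)

section \<open>Restriction to the exceptional curves\<close>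

abbreviation N where "N \<equiv> 2 * d - 1"

text \<open>\<open>center p a N\<close> still denotes coordinates of a point, but after the last
  blow-up the map is determined everywhere; hence the separate case.\<close>

definition indeterminacy :: "nat \<Rightarrow> point set" where
  "indeterminacy n = (if n = N then {} else {coords p a n (center p a n)})"

lemma indeterminacy_Suc_fst:
  assumes "n \<noteq> 1"
  shows "indeterminacy (Suc n) =
    (if Suc n = N then {} else {Exc (Suc n) (pt1 1 (snd (center p a (Suc n))))})"
  using assms by (simp add: indeterminacy_def chart_fst_def center_def)

text \<open>The second blow-up keeps the second coordinate, so the next center has direction
  [gamma:1]. Already here gamma may be nonzero: for d = 2 it is a.\<close>

lemma indeterminacy_2: "indeterminacy 2 = {Exc 2 (pt1 (snd (center p a 2)) 1)}"
proof -
  \<comment> \<open>As a natural number, \<open>2 * d - 1\<close> is odd or 0.\<close>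
  have "2 \<noteq> N" by presburger
  then show ?thesis by (simp add: indeterminacy_def chart_snd_def center_def numeral_2_eq_2)
qed

text \<open>Phrasing the value through \<open>center\<close> covers both kinds of centers: the term
  with a contributes at X = 0 only if \<open>Suc n = d\<close>, exactly when the center moves from 0
  to a.\<close>

lemma T_mid_exc:
  assumes "n < d" shows "T_mid (Suc n) 0 m = vector [m - snd (center p a (Suc n)), 0, 0]"
  using assms degree_ge by (auto simp: T_mid_def center_def power_0_left)

text \<open>A direction with nonzero parameter m in one chart has parameter 1/m in the other, so the
  center with parameter gamma appears here as m gamma = 1. For gamma = 0 it is invisible in this
  chart, and the entry is 1.\<close>

lemma W_mid_exc:
  assumes "n < d" shows "W_mid n 0 m = vector [1 - m * snd (center p a (Suc n)), 0, 0]"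
proof (cases "Suc n = d")
  case True
  then have "d - n = 1" "\<not> Suc n < d" by linarith+
  then show ?thesis using degree_ge by (simp add: W_mid_def center_def True power_0_left mult.commute)
qed (use assms degree_ge in \<open>simp add: W_mid_def center_def power_0_left\<close>)

text \<open>Only at the last stage has the exponent of X in the second entry dropped to 0;
  \<open>Y0\<close> then contributes the nonzero constant a, which excludes a further common
  zero.\<close>

lemma T_late_exc:
  assumes "k < d - 1"
  shows "T_late (Suc k) 0 m = vector [m - a * Q (Suc k), if Suc k = d - 1 then a else 0, 0]"
  using assms by (auto simp: T_late_def S_0 Y0_0_left power_0_left simp del: Q_seq.simps)

lemma W_late_exc:
  assumes "k < d - 1"
  shows "W_late k 0 m = vector [1 - m * (a * Q (Suc k)), if Suc k = d - 1 then a * m else 0, 0]"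
proof (cases "Suc k = d - 1")
  case True
  then have "d - 2 - k = 0" "d - 1 - k = 1" "d - k = 2" by linarith+
  then show ?thesis using True by (simp add: W_late_def S_0 Y0_0_left mult_ac del: Q_seq.simps(2))
next
  case False
  then have "d - 2 - k \<noteq> 0" "d - 1 - k \<noteq> 0" using assms by linarith+
  then show ?thesis using False by (simp add: W_late_def S_0 power_0_left mult_ac del: Q_seq.simps)
qed

lemma H_ext_last_fst: "H_ext (Exc N (pt1 1 m)) = abs_proj (vector [m - a * Q (d - 1), a, 0])"
  using H_ext_last[of "vector [1, m]"] by (simp add: pt1_def last_exc_map_def del: H_ext.simps)

lemma H_ext_last_snd: "H_ext (Exc N (pt1 m 1)) = abs_proj (vector [1 - m * (a * Q (d - 1)), a * m, 0])"
  using H_ext_last[of "vector [m, 1]"]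
  by (simp add: pt1_def last_exc_map_def mult_ac del: H_ext.simps)

text \<open>The induction hypothesis couples the local formula near the next center, from which the
  new charts are computed, with regularity on the whole surface away from it.\<close>

definition extends :: "nat \<Rightarrow> bool" where
  "extends n \<longleftrightarrow>
     (\<forall>w. coords p a n w \<notin> indeterminacy n \<longrightarrow>
        T n w \<noteq> 0 \<and> H_ext (coords p a n w) = abs_proj (T n w)) \<and>
     morphism_on (surface p a n) P2 (points (surface p a n) - indeterminacy n) H_ext"

lemma extends_0: "extends 0"
proof -
  have N: "0 \<noteq> N" using degree_ge by simp
  have inj: "inj Base" by (auto intro: injI)
  have "T 0 w \<noteq> 0 \<and> H_ext (coords p a 0 w) = abs_proj (T 0 w)"
    if w: "coords p a 0 w \<notin> indeterminacy 0" for w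
  proof -
    obtain u v where [simp]: "w = (u, v)" by (cases w)
    have "u \<noteq> 0 \<or> v \<noteq> 0"
      using w N degree_ge by (auto simp: indeterminacy_def center_def)
    then show ?thesis
      using H_ext_Base[of "vector [u, 1, v]"] hom_henon_neq_0[of "vector [u, 1, v]"]
      by (simp add: T_def pt2_def del: H_ext.simps)
  qed
  moreover have "morphism_on P2 P2 (- {pt2 0 1 0}) (H_ext \<circ> Base)"
  proof (rule morphism_on_proj_proj[where T = hom_henon and l = d])
    show "openin zariski_proj (- {pt2 0 1 0})" by (rule openin_proj_complement_point)
    fix v :: "complex ^ 3" assume v: "v \<noteq> 0" "abs_proj v \<in> - {pt2 0 1 0}"
    have "v $ 1 \<noteq> 0 \<or> v $ 3 \<noteq> 0"
    proof (rule ccontr)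
      assume *: "\<not> (v $ 1 \<noteq> 0 \<or> v $ 3 \<noteq> 0)"
      then have "v $ 2 \<noteq> 0" using v(1) by (auto simp: vec_eq_iff forall_3)
      then have "abs_proj v = pt2 0 1 0"
        unfolding pt2_eq_abs_proj using * by (subst pt2_eq_iff) (auto intro!: exI[of _ "inverse (v $ 2)"])
      then show False using v(2) by simp
    qed
    then show "hom_henon v \<noteq> 0 \<and> (H_ext \<circ> Base) (abs_proj v) = abs_proj (hom_henon v)"
      using H_ext_Base[OF v(1)] hom_henon_neq_0[of v] by (simp del: H_ext.simps)
  next
    fix i :: 3
    have "(\<lambda>v. hom_henon v $ i) \<in> coord_polys"
      unfolding hom_henon_def hom_p_def by (intro vector3_polyfuns polyfuns_intros) (auto intro: polyfuns.gen)
    then show "(\<lambda>v. hom_henon v $ i) \<in> homogeneous d"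
      by (simp add: homogeneous_def hom_henon_smult)
  qed
  then have "morphism_on (surface p a 0) P2 (Base ` (- {pt2 0 1 0})) H_ext"
    using morphism_on_transport[OF inj] by simp
  moreover have "points (surface p a 0) - indeterminacy 0 = Base ` (- {pt2 0 1 0})"
    using N degree_ge
    by (auto simp: indeterminacy_def center_def points_transport[OF inj] proj_space_def)
  ultimately show ?thesis unfolding extends_def by metis
qed

lemma extends_Suc:
  assumes n: "n < N" and ext: "extends n"
  shows "extends (Suc n)"
proof -
  let ?X = "surface p a n" and ?\<phi> = "coords p a n" and ?c = "center p a n" and ?e = "Exc (Suc n)"
  interpret blow_up_point ?X ?\<phi> ?c ?e
    using blow_up_point_surface by blast
  have R: "indeterminacy n = {?\<phi> ?c}" using n by (simp add: indeterminacy_def)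
  have morph: "morphism_on ?X P2 (points ?X - {?\<phi> ?c}) H_ext"
    using ext unfolding extends_def R by blast
  have rep: "T n w \<noteq> 0 \<and> H_ext (?\<phi> w) = abs_proj (T n w)" if "w \<noteq> ?c" for w
  proof -
    have "?\<phi> w \<notin> {?\<phi> ?c}" using that by (simp add: inj_eq[OF inj_coords])
    then show ?thesis using ext unfolding extends_def R by blast
  qed
  \<comment> \<open>The next center has first coordinate 0 and so lies on the curve just
    created.\<close>
  have R_Suc: "indeterminacy (Suc n) \<subseteq> {coords p a (Suc n) (center p a (Suc n))}"
      "indeterminacy (Suc n) \<subseteq> range ?e"
    by (auto simp: indeterminacy_def chart_fst_def chart_snd_def center_def)
  note morph_Suc = morphism_on_blow_up_proj[OF morph R_Suc]
  have T_Suc: "(\<lambda>w. T (Suc n) w $ i) \<in> polys2" for i by (rule T_polys) simp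
  consider "n = 0" | "n = 1" | "2 \<le> n" "n < d" | "d \<le> n" using degree_ge by linarith
  then show ?thesis
  proof cases
    case 1
    have coords_Suc: "coords p a (Suc n) = chart_fst ?\<phi> ?c ?e" using 1 by simp
    have N: "Suc n \<noteq> N" using 1 degree_ge by simp
    have c: "?c = (0, 0)" "center p a (Suc n) = (0, 0)" using degree_ge 1 by (auto simp: center_def)
    have T_n: "T n (s, s * m) = s ^ (d - 1) *s T (Suc n) (s, m)"
        "T n (s * m, s) = s ^ (d - 1) *s W_first s m" for s m
      using T_0_fst T_0_snd 1 by simp_all
    \<comment> \<open>On the new curve the first entry vanishes only at m = 0 in the first chart,
      and nowhere in the second.\<close>
    have T_exc: "T (Suc n) (0, m) = vector [- a * m ^ (d - 1), 0, 0]" "W_first 0 m = vector [- a, 0, 0]" for m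
      using 1 degree_ge by (simp_all add: T_def T_mid_def W_first_def)
    have \<gamma>: "indeterminacy (Suc n) = {?e (pt1 1 0)}"
      using indeterminacy_Suc_fst[of n] 1 N c(2) by simp
    have T_rep: "T (Suc n) w \<noteq> 0 \<and> H_ext (chart_fst ?\<phi> ?c ?e w) = abs_proj (T (Suc n) w)"
      if "chart_fst ?\<phi> ?c ?e w \<notin> indeterminacy (Suc n)" for w
      by (rule represented_chart_fst[where T = "T n" and T' = "T (Suc n)" and j = "d - 1", OF rep _ _ that])
        (use N c a_neq \<gamma> in \<open>auto simp: T_n T_exc abs_proj_q\<close>)
    moreover have "W_first (fst w) (snd w) \<noteq> 0 \<and>
        H_ext (chart_snd ?\<phi> ?c ?e w) = abs_proj (W_first (fst w) (snd w))"
      if "chart_snd ?\<phi> ?c ?e w \<notin> indeterminacy (Suc n)" for w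
      by (rule represented_chart_snd[where T = "T n" and T' = "\<lambda>w. W_first (fst w) (snd w)"
          and j = "d - 1", OF rep _ _ that])
        (use N c a_neq in \<open>auto simp: T_n T_exc abs_proj_q\<close>)
    ultimately have "morphism_on (surface p a (Suc n)) P2
        (points (surface p a (Suc n)) - indeterminacy (Suc n)) H_ext"
      unfolding surface.simps(2) by (intro morph_Suc[OF T_Suc W_first_polys])
    then show ?thesis unfolding extends_def coords_Suc using T_rep by blast
  next
    case 2
    have coords_Suc: "coords p a (Suc n) = chart_snd ?\<phi> ?c ?e" using 2 by simp
    have N: "Suc n \<noteq> N" using 2 by presburger
    have c: "?c = (0, 0)" using degree_ge 2 by (auto simp: center_def)
    let ?\<gamma> = "snd (center p a (Suc n))"
    have \<gamma>: "indeterminacy (Suc n) = {?e (pt1 ?\<gamma> 1)}"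
      using indeterminacy_2 2 by (simp add: numeral_2_eq_2)
    have "n < d" using 2 degree_ge by simp
    note * = T_mid_fst[OF this] T_mid_snd[OF this] T_mid_exc[OF this] W_mid_exc[OF this]
    \<comment> \<open>The coordinates are (u, X_1), while \<open>T_mid\<close> expects X_1 first.
      Passing to \<open>chart_snd\<close> restores that order, so in this case \<open>T\<close> and
      \<open>W_mid\<close> trade charts.\<close>
    have T_n: "T n w = T_mid n (snd w) (fst w)" "T (Suc n) w = T_mid (Suc n) (fst w) (snd w)" for w
      using 2 degree_ge by (simp_all add: T_def)
    have T_rep: "T (Suc n) w \<noteq> 0 \<and> H_ext (chart_snd ?\<phi> ?c ?e w) = abs_proj (T (Suc n) w)"
      if "chart_snd ?\<phi> ?c ?e w \<notin> indeterminacy (Suc n)" for w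
      by (rule represented_chart_snd[where T = "T n" and T' = "T (Suc n)" and j = 1, OF rep _ _ that])
        (use N c \<gamma> in \<open>auto simp: T_n * abs_proj_q\<close>)
    moreover have "W_mid n (fst w) (snd w) \<noteq> 0 \<and>
        H_ext (chart_fst ?\<phi> ?c ?e w) = abs_proj (W_mid n (fst w) (snd w))"
      if "chart_fst ?\<phi> ?c ?e w \<notin> indeterminacy (Suc n)" for w
      by (rule represented_chart_fst[where T = "T n" and T' = "\<lambda>w. W_mid n (fst w) (snd w)"
          and j = 1, OF rep _ _ that])
        (use N c \<gamma> in \<open>auto simp: T_n * abs_proj_q\<close>)
    ultimately have "morphism_on (surface p a (Suc n)) P2
        (points (surface p a (Suc n)) - indeterminacy (Suc n)) H_ext"
      unfolding surface.simps(2) by (intro morph_Suc[OF W_mid_polys T_Suc])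
    then show ?thesis unfolding extends_def coords_Suc using T_rep by blast
  next
    case 3
    have coords_Suc: "coords p a (Suc n) = chart_fst ?\<phi> ?c ?e" using 3 by simp
    have N: "Suc n \<noteq> N" using 3 by linarith
    have c: "?c = (0, 0)" using 3 by (auto simp: center_def)
    let ?\<gamma> = "snd (center p a (Suc n))"
    have \<gamma>: "indeterminacy (Suc n) = {?e (pt1 1 ?\<gamma>)}"
      using indeterminacy_Suc_fst[of n] 3 N by simp
    note * = T_mid_fst[OF 3(2)] T_mid_snd[OF 3(2)] T_mid_exc[OF 3(2)] W_mid_exc[OF 3(2)]
    have T_n: "T n w = T_mid n (fst w) (snd w)" "T (Suc n) w = T_mid (Suc n) (fst w) (snd w)" for w
      using 3 by (simp_all add: T_def)
    have T_rep: "T (Suc n) w \<noteq> 0 \<and> H_ext (chart_fst ?\<phi> ?c ?e w) = abs_proj (T (Suc n) w)"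
      if "chart_fst ?\<phi> ?c ?e w \<notin> indeterminacy (Suc n)" for w
      by (rule represented_chart_fst[where T = "T n" and T' = "T (Suc n)" and j = 1, OF rep _ _ that])
        (use N c \<gamma> in \<open>auto simp: T_n * abs_proj_q\<close>)
    moreover have "W_mid n (fst w) (snd w) \<noteq> 0 \<and>
        H_ext (chart_snd ?\<phi> ?c ?e w) = abs_proj (W_mid n (fst w) (snd w))"
      if "chart_snd ?\<phi> ?c ?e w \<notin> indeterminacy (Suc n)" for w
      by (rule represented_chart_snd[where T = "T n" and T' = "\<lambda>w. W_mid n (fst w) (snd w)"
          and j = 1, OF rep _ _ that])
        (use N c \<gamma> in \<open>auto simp: T_n * abs_proj_q\<close>)
    ultimately have "morphism_on (surface p a (Suc n)) P2
        (points (surface p a (Suc n)) - indeterminacy (Suc n)) H_ext"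
      unfolding surface.simps(2) by (intro morph_Suc[OF T_Suc W_mid_polys])
    then show ?thesis unfolding extends_def coords_Suc using T_rep by blast
  next
    case 4
    have coords_Suc: "coords p a (Suc n) = chart_fst ?\<phi> ?c ?e" using 4 degree_ge by simp
    from 4 obtain k where k: "n = d + k" using le_iff_add by blast
    have kd: "k < d - 1" using n k by linarith
    have last: "Suc n = N \<longleftrightarrow> Suc k = d - 1" using k degree_ge by linarith
    have c: "?c = (0, a * Q k)" "center p a (Suc n) = (0, a * Q (Suc k))"
      using k by (simp_all add: center_def Suc_diff_le)
    have \<gamma>: "indeterminacy (Suc n) = (if Suc k = d - 1 then {} else {?e (pt1 1 (a * Q (Suc k)))})"
      using indeterminacy_Suc_fst[of n] 4 degree_ge last c(2) by simp
    note * = T_late_fst[OF kd] T_late_snd[OF kd] T_late_exc[OF kd] W_late_exc[OF kd]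
    have T_n: "T n w = T_late k (fst w) (snd w)" "T (Suc n) w = T_late (Suc k) (fst w) (snd w)" for w
      using T_add_degree[of k] T_add_degree[of "Suc k"] k by simp_all
    have T_rep: "T (Suc n) w \<noteq> 0 \<and> H_ext (chart_fst ?\<phi> ?c ?e w) = abs_proj (T (Suc n) w)"
      if "chart_fst ?\<phi> ?c ?e w \<notin> indeterminacy (Suc n)" for w
    proof (rule represented_chart_fst[where T = "T n" and T' = "T (Suc n)" and j = 1, OF rep _ _ that])
      fix m assume m: "?e (pt1 1 m) \<notin> indeterminacy (Suc n)"
      show "T (Suc n) (0, m) \<noteq> 0 \<and> H_ext (?e (pt1 1 m)) = abs_proj (T (Suc n) (0, m))"
      proof (cases "Suc k = d - 1")
        case True
        then have "Suc n = N" using last by blast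
        then show ?thesis using H_ext_last_fst[of m] True a_neq
          unfolding T_n fst_conv snd_conv * unfolding \<open>Suc n = N\<close> by (simp del: H_ext.simps)
      next
        case False
        then have "H_ext (?e (pt1 1 m)) = pt2 1 0 0" using last by simp
        moreover have "m - a * Q (Suc k) \<noteq> 0" using m \<gamma> False by (auto simp del: Q_seq.simps)
        ultimately show ?thesis using False unfolding T_n fst_conv snd_conv *
          by (simp add: abs_proj_q del: Q_seq.simps H_ext.simps)
      qed
    qed (use c in \<open>auto simp: T_n *\<close>)
    moreover have "W_late k (fst w) (snd w) \<noteq> 0 \<and>
        H_ext (chart_snd ?\<phi> ?c ?e w) = abs_proj (W_late k (fst w) (snd w))"
      if "chart_snd ?\<phi> ?c ?e w \<notin> indeterminacy (Suc n)" for w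
    proof (rule represented_chart_snd[where T = "T n" and T' = "\<lambda>w. W_late k (fst w) (snd w)"
          and j = 1, OF rep _ _ that])
      fix m assume m: "?e (pt1 m 1) \<notin> indeterminacy (Suc n)"
      show "W_late k (fst (0, m)) (snd (0, m)) \<noteq> 0 \<and>
          H_ext (?e (pt1 m 1)) = abs_proj (W_late k (fst (0, m)) (snd (0, m)))"
      proof (cases "Suc k = d - 1")
        case True
        then have "Suc n = N" using last by blast
        \<comment> \<open>Either m = 0 and the first entry is 1, or the second entry a m is
          nonzero.\<close>
        then show ?thesis using H_ext_last_snd[of m] True a_neq
          unfolding fst_conv snd_conv * unfolding \<open>Suc n = N\<close> by (auto simp del: H_ext.simps)
      next
        case False
        then have "H_ext (?e (pt1 m 1)) = pt2 1 0 0" using last by simp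
        moreover have "1 - m * (a * Q (Suc k)) \<noteq> 0" using m \<gamma> False by (auto simp del: Q_seq.simps)
        ultimately show ?thesis using False unfolding fst_conv snd_conv *
          by (simp add: abs_proj_q del: Q_seq.simps H_ext.simps)
      qed
    qed (use c in \<open>auto simp: T_n *\<close>)
    ultimately have "morphism_on (surface p a (Suc n)) P2
        (points (surface p a (Suc n)) - indeterminacy (Suc n)) H_ext"
      unfolding surface.simps(2) by (intro morph_Suc[OF T_Suc W_late_polys])
    then show ?thesis unfolding extends_def coords_Suc using T_rep by blast
  qed
qed

lemma extends: "n \<le> N \<Longrightarrow> extends n"
  by (induction n) (auto intro: extends_0 extends_Suc)


subsection \<open>The divisor at infinity\<close>

lemma N_eq_Suc: "N = Suc (2 * d - 2)"
  using degree_ge by simp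

lemma H_ext_morphism: "morphism_on (X_tilde p a) P2 (points (X_tilde p a)) H_ext"
  using extends[of N] unfolding extends_def X_tilde_def by (simp add: indeterminacy_def)

text \<open>The first blow-up removes [0:1:0], and later ones only add points named
  \<open>Exc\<close>. Without this, the computation on the line at infinity would meet the one point
  where \<open>hom_henon\<close> vanishes.\<close>

lemma points_X_tilde_subset:
  "points (X_tilde p a) \<subseteq> Base ` (- {pt2 0 1 0}) \<union> {Exc k l | k l. k \<le> N}"
proof -
  have "Base (pt2 0 1 0) \<notin> points (surface p a (Suc n))" for n
  proof (induction n)
    case 0
    interpret blow_up_point "surface p a 0" "coords p a 0" "center p a 0" "Exc (Suc 0)"
      using blow_up_point_surface by blast
    have "coords p a 0 (center p a 0) = Base (pt2 0 1 0)"
      using degree_ge by (simp add: center_def)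
    then show ?case unfolding surface.simps(2) points_blow_up by auto
  next
    case (Suc n)
    interpret blow_up_point "surface p a (Suc n)" "coords p a (Suc n)" "center p a (Suc n)"
        "Exc (Suc (Suc n))"
      using blow_up_point_surface by blast
    have "Base (pt2 0 1 0) \<notin> range (Exc (Suc (Suc n)))" by auto
    then show ?case using Suc unfolding surface.simps(2)[of p a "Suc n"] points_blow_up by blast
  qed
  then have "Base (pt2 0 1 0) \<notin> points (X_tilde p a)" unfolding X_tilde_def N_eq_Suc by blast
  moreover have "points (X_tilde p a) \<subseteq> range Base \<union> {Exc k l | k l. k \<le> N}"
    using blow_up_point_surface[of p a N] unfolding X_tilde_def by blast
  ultimately show ?thesis by blast
qed

lemma last_exceptional_subset: "range (Exc N) \<subseteq> points (X_tilde p a)"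
proof -
  interpret blow_up_point "surface p a (2 * d - 2)" "coords p a (2 * d - 2)" "center p a (2 * d - 2)"
      "Exc (Suc (2 * d - 2))"
    using blow_up_point_surface by blast
  show ?thesis unfolding X_tilde_def N_eq_Suc surface.simps(2) points_blow_up by blast
qed

text \<open>Such a point lies either on the line at infinity away from [0:1:0], where only the entry
  x^d remains, or on an earlier exceptional curve, where \<open>H_ext\<close> is constant by
  definition.\<close>

lemma H_ext_D_tilde:
  assumes "x \<in> D_tilde p a" "x \<notin> range (Exc N)"
  shows "H_ext x = pt2 1 0 0"
proof (cases x)
  case (Base P)
  obtain x' y z where P: "(x', y, z) \<noteq> (0, 0, 0)" "P = pt2 x' y z" by (rule pt2_cases)
  have "z = 0"
  proof (rule ccontr)
    assume "z \<noteq> 0"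
    then have "pt2 x' y z = emb (x' / z, y / z)"
      unfolding emb_def prod.case by (subst pt2_eq_iff) (auto intro!: exI[of _ "inverse z"] simp: field_simps)
    then show False using assms(1) P(2) Base by (auto simp: D_tilde_def)
  qed
  moreover have "x' \<noteq> 0"
  proof
    assume "x' = 0"
    then have "pt2 x' y z = pt2 0 1 0"
      using P(1) \<open>z = 0\<close> by (subst pt2_eq_iff) (auto intro!: exI[of _ "inverse y"])
    then show False using assms(1) points_X_tilde_subset P(2) Base by (auto simp: D_tilde_def)
  qed
  ultimately show ?thesis using H_ext_infinity P Base by blast
next
  case (Exc n l)
  then have "n \<noteq> N" using assms(2) by blast
  then show ?thesis using Exc by simp
qed

section \<open>The last exceptional curve and the line at infinity\<close>

lemma H_ext_last_pt1:
  assumes "(\<alpha>, \<beta>) \<noteq> (0, 0)"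
  shows "H_ext (Exc N (pt1 \<alpha> \<beta>)) = pt2 (\<beta> - a * Q (d - 1) * \<alpha>) (a * \<alpha>) 0"
  using H_ext_last[of "vector [\<alpha>, \<beta>]"] assms
  by (simp add: pt1_def pt2_def last_exc_map_def del: H_ext.simps)

lemma H_ext_last_in: "H_ext ` range (Exc N) \<subseteq> l_inf"
proof -
  have "H_ext (Exc N l) \<in> l_inf" for l
  proof -
    obtain \<alpha> \<beta> where l: "(\<alpha>, \<beta>) \<noteq> (0, 0)" "l = pt1 \<alpha> \<beta>" by (rule pt1_cases)
    have "(\<beta> - a * Q (d - 1) * \<alpha>, a * \<alpha>) \<noteq> (0, 0)" using l(1) a_neq by auto
    then show ?thesis unfolding l(2) H_ext_last_pt1[OF l(1)] l_inf_def by blast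
  qed
  then show ?thesis by blast
qed

text \<open>Solves x = beta - a Q_{d-1} alpha and y = a alpha for (alpha, beta).\<close>

definition line_inv_vec :: "complex ^ 3 \<Rightarrow> complex ^ 2" where
  "line_inv_vec v = vector [v $ 2 / a, v $ 1 + Q (d - 1) * v $ 2]"

definition line_inv :: "3 proj \<Rightarrow> point" where
  "line_inv P = Exc N (abs_proj (line_inv_vec (rep_proj P)))"

lemma line_inv_pt2:
  assumes "(x, y) \<noteq> (0, 0)"
  shows "line_inv (pt2 x y 0) = Exc N (pt1 (y / a) (x + Q (d - 1) * y))"
proof -
  have "line_inv_vec (c *s v) = c ^ 1 *s line_inv_vec v" for c v
    by (simp add: line_inv_vec_def smult_vector2 algebra_simps)
  from abs_proj_equivariant[OF this, of "vector [x, y, 0]"] show ?thesis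
    using assms a_neq by (auto simp: line_inv_def line_inv_vec_def pt1_def pt2_def)
qed

lemma line_inv_H_ext: "line_inv (H_ext (Exc N l)) = Exc N l"
proof -
  obtain \<alpha> \<beta> where l: "(\<alpha>, \<beta>) \<noteq> (0, 0)" "l = pt1 \<alpha> \<beta>" by (rule pt1_cases)
  have "(\<beta> - a * Q (d - 1) * \<alpha>, a * \<alpha>) \<noteq> (0, 0)" using l(1) a_neq by auto
  then have "line_inv (H_ext (Exc N l)) =
      Exc N (pt1 (a * \<alpha> / a) (\<beta> - a * Q (d - 1) * \<alpha> + Q (d - 1) * (a * \<alpha>)))"
    unfolding l(2) H_ext_last_pt1[OF l(1)] by (rule line_inv_pt2)
  also have "\<dots> = Exc N (pt1 \<alpha> \<beta>)" using a_neq by (simp add: mult_ac)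
  finally show ?thesis unfolding l(2) .
qed

lemma H_ext_line_inv:
  assumes "P \<in> l_inf"
  shows "H_ext (line_inv P) = P"
proof -
  obtain x y where P: "(x, y) \<noteq> (0, 0)" "P = pt2 x y 0" using assms by (auto simp: l_inf_def)
  have "(y / a, x + Q (d - 1) * y) \<noteq> (0, 0)" using P(1) a_neq by auto
  then have "H_ext (line_inv P) =
      pt2 (x + Q (d - 1) * y - a * Q (d - 1) * (y / a)) (a * (y / a)) 0"
    unfolding P(2) line_inv_pt2[OF P(1)] by (rule H_ext_last_pt1)
  also have "\<dots> = pt2 x y 0" using a_neq by simp
  finally show ?thesis unfolding P(2) .
qed

lemma coord_forms:
  "(\<lambda>_. 0) \<in> homogeneous 1" "(\<lambda>v. b * v $ i) \<in> homogeneous 1"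
  "(\<lambda>v. v $ i + b * v $ j) \<in> homogeneous 1" "(\<lambda>v. c * (v $ i + b * v $ j)) \<in> homogeneous 1"
proof -
  show 1: "(\<lambda>v. b * v $ i) \<in> homogeneous 1" for b i
    by (intro homogeneous_smult component_homogeneous)
  show "(\<lambda>_. 0) \<in> homogeneous 1" using 1[of 0] by simp
  show 2: "(\<lambda>v. v $ i + b * v $ j) \<in> homogeneous 1"
    by (intro homogeneous_add 1 component_homogeneous)
  show "(\<lambda>v. c * (v $ i + b * v $ j)) \<in> homogeneous 1"
    by (intro homogeneous_smult 2)
qed

text \<open>
  Locally on the line at infinity, the inverse is a map to the affine plane followed by one of
  the two charts of the last blow-up.
\<close>

lemma line_inv_morphism:
  "morphism (subvariety P2 l_inf) (subvariety (X_tilde p a) (range (Exc N))) line_inv"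
proof (rule morphism_subvarieties)
  let ?\<phi> = "coords p a (2 * d - 2)" and ?c = "center p a (2 * d - 2)" and ?e = "Exc N"
  let ?Q = "Q (d - 1)"
  have X: "X_tilde p a = blow_up (surface p a (2 * d - 2)) ?\<phi> ?c ?e"
    unfolding X_tilde_def N_eq_Suc surface.simps(2) ..
  have line_inv_abs: "line_inv (abs_proj v) = Exc N (pt1 (v $ 2 / a) (v $ 1 + ?Q * v $ 2))"
    if v: "v \<noteq> 0" "abs_proj v \<in> l_inf" for v :: "complex ^ 3"
  proof -
    obtain x y where xy: "(x, y) \<noteq> (0, 0)" "abs_proj v = pt2 x y 0" using v(2) by (auto simp: l_inf_def)
    then obtain c where "c \<noteq> 0" "vector [x, y, 0] = c *s v"
      using abs_proj_eq_iff[OF v(1), of "vector [x, y, 0]"] by (auto simp: pt2_def)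
    then have "c * v $ 3 = 0" by (metis vector_3(3) vector_smult_component)
    then have "v $ 3 = 0" using \<open>c \<noteq> 0\<close> by simp
    then have "(v $ 1, v $ 2) \<noteq> (0, 0)" using v(1) by (auto simp: vec_eq_iff forall_3)
    then show ?thesis using line_inv_pt2 \<open>v $ 3 = 0\<close> by (simp add: pt2_eq_abs_proj)
  qed
  fix P assume P: "P \<in> points P2 \<inter> l_inf"
  then obtain x y where xy: "(x, y) \<noteq> (0, 0)" "P = pt2 x y 0" by (auto simp: l_inf_def)
  show "\<exists>U f. P \<in> U \<and> morphism_on P2 (X_tilde p a) U f \<and> (\<forall>w\<in>U \<inter> l_inf. line_inv w = f w)"
  proof (cases "y = 0")
    case False
    \<comment> \<open>The exceptional curve is s = 0 in the first chart, and its parameter there is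
      beta/alpha = a (x + Q_{d-1} y)/y, a quotient of linear forms defined where y is
      nonzero.\<close>
    let ?C = "\<lambda>v :: complex ^ 3. a * (v $ 1 + ?Q * v $ 2)" and ?B = "\<lambda>v :: complex ^ 3. 1 * v $ 2"
    let ?M = "ratio_map (\<lambda>_. 0) ?C ?B"
    have "morphism_on P2 (X_tilde p a) {abs_proj v | v. v \<noteq> 0 \<and> ?B v \<noteq> 0} (chart_fst ?\<phi> ?c ?e \<circ> ?M)"
      unfolding X by (rule morphism_on_comp[OF morphism_on_ratio_map[OF coord_forms(1,4,2)] morphism_on_chart_fst])
    moreover have "line_inv (abs_proj v) = (chart_fst ?\<phi> ?c ?e \<circ> ?M) (abs_proj v)"
      if v: "v \<noteq> 0" "v $ 2 \<noteq> 0" "abs_proj v \<in> l_inf" for v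
    proof -
      have "?M (abs_proj v) = (0, ?C v / v $ 2)"
        using ratio_map_abs_proj[OF coord_forms(1,4,2) v(1), of a 1 ?Q 2 1 2] by simp
      moreover have "pt1 (v $ 2 / a) (v $ 1 + ?Q * v $ 2) = pt1 1 (?C v / v $ 2)"
        using v(2) a_neq by (subst pt1_eq_iff) (auto intro!: exI[of _ "a / v $ 2"])
      ultimately show ?thesis using line_inv_abs[OF v(1,3)] by (simp add: chart_fst_def)
    qed
    moreover have "P \<in> {abs_proj v | v. v \<noteq> 0 \<and> ?B v \<noteq> 0}"
      using xy False by (auto simp: pt2_def intro!: exI[of _ "vector [x, y, 0]"])
    ultimately show ?thesis
      by (intro exI[of _ "{abs_proj v | v. v \<noteq> 0 \<and> ?B v \<noteq> 0}"]
          exI[of _ "chart_fst ?\<phi> ?c ?e \<circ> ?M"]) auto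
  next
    case True
    \<comment> \<open>Now y = 0, so beta = x is nonzero at \<open>P\<close>, and the parameter
      alpha/beta of the second chart is defined nearby.\<close>
    let ?A = "\<lambda>v :: complex ^ 3. inverse a * v $ 2" and ?B = "\<lambda>v :: complex ^ 3. v $ 1 + ?Q * v $ 2"
    let ?M = "ratio_map (\<lambda>_. 0) ?A ?B"
    have "morphism_on P2 (X_tilde p a) {abs_proj v | v. v \<noteq> 0 \<and> ?B v \<noteq> 0} (chart_snd ?\<phi> ?c ?e \<circ> ?M)"
      unfolding X by (rule morphism_on_comp[OF morphism_on_ratio_map[OF coord_forms(1,2,3)] morphism_on_chart_snd])
    moreover have "line_inv (abs_proj v) = (chart_snd ?\<phi> ?c ?e \<circ> ?M) (abs_proj v)"
      if v: "v \<noteq> 0" "?B v \<noteq> 0" "abs_proj v \<in> l_inf" for v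
    proof -
      have "?M (abs_proj v) = (0, ?A v / ?B v)"
        using ratio_map_abs_proj[OF coord_forms(1,2,3) v(1), of "inverse a" 2 1 ?Q 2] by simp
      moreover have "pt1 (v $ 2 / a) (?B v) = pt1 (?A v / ?B v) 1"
        using pt1_div_right[OF v(2), of "v $ 2 / a"] by (simp add: divide_inverse mult_ac)
      ultimately show ?thesis using line_inv_abs[OF v(1,3)] by (simp add: chart_snd_def)
    qed
    moreover have "P \<in> {abs_proj v | v. v \<noteq> 0 \<and> ?B v \<noteq> 0}"
      using xy True by (auto simp: pt2_def intro!: exI[of _ "vector [x, y, 0]"])
    ultimately show ?thesis
      by (intro exI[of _ "{abs_proj v | v. v \<noteq> 0 \<and> ?B v \<noteq> 0}"]
          exI[of _ "chart_snd ?\<phi> ?c ?e \<circ> ?M"]) auto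
  qed
next
  show "line_inv ` (points P2 \<inter> l_inf) \<subseteq> points (X_tilde p a) \<inter> range (Exc N)"
    using last_exceptional_subset by (auto simp: line_inv_def)
qed

lemma H_ext_isomorphism:
  "isomorphism (subvariety (X_tilde p a) (range (Exc N))) (subvariety P2 l_inf) H_ext"
proof -
  have "morphism (subvariety (X_tilde p a) (range (Exc N))) (subvariety P2 l_inf) H_ext"
    by (rule morphism_subvarieties) (use H_ext_morphism H_ext_last_in in auto)
  moreover have "\<forall>x\<in>points (subvariety (X_tilde p a) (range (Exc N))). line_inv (H_ext x) = x"
    using line_inv_H_ext by (auto simp: subvariety_def simp del: H_ext.simps)
  moreover have "\<forall>y\<in>points (subvariety P2 l_inf). H_ext (line_inv y) = y"
    using H_ext_line_inv by (auto simp: subvariety_def)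
  ultimately show ?thesis unfolding isomorphism_def using line_inv_morphism by blast
qed

end

theorem mainTheorem1:
  fixes p :: "complex poly" and a :: complex
  assumes "lead_coeff p = 1" and "degree p \<ge> 2" and "a \<noteq> 0"
  shows "\<exists>H'. morphism (X_tilde p a) P2 H' \<and>
              (\<forall>z. H' (Base (emb z)) = emb (henon p a z)) \<and>
              H' ` D_tilde p a \<subseteq> l_inf \<and>
              (\<forall>x \<in> D_tilde p a - last_exceptional p. H' x = pt2 1 0 0) \<and>
              isomorphism (subvariety (X_tilde p a) (last_exceptional p)) (subvariety P2 l_inf) H'"
proof -
  interpret monic_henon p a by unfold_locales (use assms in auto)
  have last: "last_exceptional p = range (Exc N)" by (simp add: last_exceptional_def)
  have "pt2 1 0 0 \<in> l_inf" unfolding l_inf_def by (intro CollectI exI[of _ 1] exI[of _ 0]) simp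
  then have "H_ext ` D_tilde p a \<subseteq> l_inf"
    using H_ext_D_tilde H_ext_last_in by (metis image_subset_iff imageI)
  moreover have "morphism (X_tilde p a) P2 H_ext"
    using morphism_on_imp_morphism[OF H_ext_morphism] by simp
  ultimately show ?thesis
    unfolding last using H_ext_emb H_ext_D_tilde H_ext_isomorphism by blast
qed

end
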